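(* Let $G$ be a compact Hausdorff group, $X$ a complete operator space, and $\nu\in M_{ac}(G,X)$. Then: (i) If $f\in L^1_w(\nu)$ then $\widehat{f}_\nu\in\mathcal{B}\left(X',\ell^\infty\text{-}\bigoplus_{[\pi]\in\widehat{G}}M_{d_\pi}\right)$. In fact, $\sup_{[\pi]\in\widehat{G}}\|\widehat{f}_\nu(x')(\pi)\|_{M_{d_\pi}}\leq\|f\|_\nu\|x'\|$ for all $x'\in X'$. (ii) The Fourier transform operator $\mathcal{F}_\nu:L^1_w(\nu)\to\mathcal{B}\left(X',\ell^\infty\text{-}\bigoplus_{[\pi]\in\widehat{G}}M_{d_\pi}\right)$ given by $\mathcal{F}_\nu(f)=\widehat{f}_\nu$ is completely bounded.
   Context: $m_G$ is normalized Haar measure on $G$. $X'$ is the dual of $X$ with closed unit ball $B_{X'}$. $M_{ac}(G,X)$ is the space of $\sigma$-additive $X$-valued vector measures $\nu$ on the Borel sets of $G$ with $\lim_{m_G(A)\to0}\nu(A)=0$. For $x'\in X'$, $\langle\nu,x'\rangle(A)=\langle\nu(A),x'\rangle$ with total variation $|\langle\nu,x'\rangle|$, and $h_{x'}\in L^1(G)$ is the Radon–Nikodym derivative, $d\langle\nu,x'\rangle=h_{x'}\,dm_G$. $L^1_w(\nu)$ is the Banach space of $\nu$-weakly integrable functions $f:G\to\mathbb{C}$ ($f\in L^1(|\langle\nu,x'\rangle|)$ for all $x'\in X'$) with norm $\|f\|_\nu=\sup_{x'\in B_{X'}}\int_G|f|\,d|\langle\nu,x'\rangle|$. For such $f$,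 $fh_{x'}\in L^1(G)$. $\widehat G$ is the set of unitary equivalence classes of irreducible unitary representations $\pi$ of $G$, $d_\pi=\dim\mathcal{H}_\pi$, and (after fixing orthonormal bases) $\pi(t)$ is a $d_\pi\times d_\pi$ matrix. For $g\in L^1(G)$, $\widehat g(\pi)=\frac1{d_\pi}\int_Gg(t)\pi(t)^*\,dm_G(t)\in M_{d_\pi}$. The Fourier transform of $f\in L^1_w(\nu)$ is defined by $\widehat f_\nu(x')(\pi)=\widehat{fh_{x'}}(\pi)$ for $x'\in X'$, $[\pi]\in\widehat{G}$. $M_n$ is the space of complex $n\times n$ matrices with operator norm; $\ell^\infty\text{-}\bigoplus_\alpha X_\alpha$ is the space of bounded families with the sup norm, with matrix norms $M_n(\ell^\infty\text{-}\bigoplus X_\alpha)=\ell^\infty\text{-}\bigoplus M_n(X_\alpha)$. The operator space structure on $L^1_w(\nu)$ is given by $\|[f_{ij}]\|_{M_n(L^1_w(\nu))}=\sup_{y'\in B_{(M_n)'}}\|\langle \widetilde f,y'\rangle\|_\nu$, where $\widetilde f(t)=[f_{ij}(t)]\in M_n$. For an operator space $W$, $\mathcal{B}(X',W)$ (bounded linear maps) carries the matrix norms from the identification $M_n(\mathcal{B}(X',W))=\mathcal{B}(X',M_n(W))$. A linear map $\varphi$ is completely bounded if its amplifications $\varphi_n([x_{ij}])=[\varphi(x_{ij})]$ satisfy $\sup_n\|\varphi_n\|<\infty$. *)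

theory Defs
  imports "HOL-Analysis.Analysis" "HOL-Library.Function_Algebras"
begin

section \<open>Complex vector spaces and matrices over them\<close>

class complex_vector = ab_group_add +
  fixes scaleC :: "complex \<Rightarrow> 'a \<Rightarrow> 'a"  (infixr \<open>*\<^sub>C\<close> 75)
  assumes scaleC_add_right: "a *\<^sub>C (x + y) = a *\<^sub>C x + a *\<^sub>C y"
    and scaleC_add_left: "(a + b) *\<^sub>C x = a *\<^sub>C x + b *\<^sub>C x"
    and scaleC_scaleC: "a *\<^sub>C (b *\<^sub>C x) = (a * b) *\<^sub>C x"
    and scaleC_one: "1 *\<^sub>C x = x"

instantiation complex :: complex_vector
begin
definition "scaleC_complex (a::complex) (x::complex) = a * x"
instance by standard (auto simp: scaleC_complex_def algebra_simps)
end

text \<open>Function types carry the pointwise structure, so matrices, functions on the group, families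
  and operators are all elements of complex vector spaces.\<close>

instantiation "fun" :: (type, complex_vector) complex_vector
begin
definition "scaleC_fun (a::complex) (f::'a \<Rightarrow> 'b) = (\<lambda>x. a *\<^sub>C f x)"
instance
  by standard (auto simp: scaleC_fun_def fun_eq_iff scaleC_add_right scaleC_add_left
      scaleC_scaleC scaleC_one)
end

global_interpretation complex_vector: vector_space "scaleC :: complex \<Rightarrow> 'a \<Rightarrow> 'a::complex_vector"
  by standard (auto simp: scaleC_add_right scaleC_add_left scaleC_scaleC scaleC_one)

abbreviation csubspace :: "'a::complex_vector set \<Rightarrow> bool"
  where "csubspace \<equiv> module.subspace scaleC"

text \<open>An \<open>m \<times> n\<close> matrix is a function of two indices (counted from 0) vanishing outside the
  index range.\<close>

definition matrices :: "nat \<Rightarrow> nat \<Rightarrow> 'a::zero set \<Rightarrow> (nat \<Rightarrow> nat \<Rightarrow> 'a) set"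
  where "matrices m n V =
    {A. (\<forall>i<m. \<forall>j<n. A i j \<in> V) \<and> (\<forall>i j. \<not> (i < m \<and> j < n) \<longrightarrow> A i j = 0)}"

definition mat_vec :: "nat \<Rightarrow> (nat \<Rightarrow> nat \<Rightarrow> complex) \<Rightarrow> (nat \<Rightarrow> complex) \<Rightarrow> nat \<Rightarrow> complex"
  where "mat_vec n A v = (\<lambda>i. \<Sum>j<n. A i j * v j)"

definition mat_mult ::
  "nat \<Rightarrow> (nat \<Rightarrow> nat \<Rightarrow> complex) \<Rightarrow> (nat \<Rightarrow> nat \<Rightarrow> complex) \<Rightarrow> nat \<Rightarrow> nat \<Rightarrow> complex"
  where "mat_mult n A B = (\<lambda>i j. \<Sum>k<n. A i k * B k j)"

definition mat_one :: "nat \<Rightarrow> nat \<Rightarrow> nat \<Rightarrow> complex"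
  where "mat_one n = (\<lambda>i j. if i = j \<and> i < n then 1 else 0)"

definition mat_adj :: "(nat \<Rightarrow> nat \<Rightarrow> complex) \<Rightarrow> nat \<Rightarrow> nat \<Rightarrow> complex"
  where "mat_adj A = (\<lambda>i j. cnj (A j i))"

definition unitary_mat :: "nat \<Rightarrow> (nat \<Rightarrow> nat \<Rightarrow> complex) \<Rightarrow> bool"
  where "unitary_mat n U \<longleftrightarrow> U \<in> matrices n n UNIV \<and>
    mat_mult n (mat_adj U) U = mat_one n \<and> mat_mult n U (mat_adj U) = mat_one n"

definition op_norm :: "nat \<Rightarrow> nat \<Rightarrow> (nat \<Rightarrow> nat \<Rightarrow> complex) \<Rightarrow> real"
  where "op_norm m n A =
    (SUP v\<in>{v. L2_set (\<lambda>j. cmod (v j)) {..<n} \<le> 1}. L2_set (\<lambda>i. cmod (mat_vec n A v i)) {..<m})"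


section \<open>Normed spaces and bounded maps, relative to carriers\<close>

definition norm_on :: "'a::complex_vector set \<Rightarrow> ('a \<Rightarrow> real) \<Rightarrow> bool"
  where "norm_on V p \<longleftrightarrow>
    (\<forall>x\<in>V. 0 \<le> p x \<and> (p x = 0 \<longleftrightarrow> x = 0)) \<and>
    (\<forall>x\<in>V. \<forall>y\<in>V. p (x + y) \<le> p x + p y) \<and>
    (\<forall>a. \<forall>x\<in>V. p (a *\<^sub>C x) = cmod a * p x)"

definition clinear_on :: "'a::complex_vector set \<Rightarrow> ('a \<Rightarrow> 'b::complex_vector) \<Rightarrow> bool"
  where "clinear_on V T \<longleftrightarrow>
    (\<forall>x\<in>V. \<forall>y\<in>V. T (x + y) = T x + T y) \<and> (\<forall>a. \<forall>x\<in>V. T (a *\<^sub>C x) = a *\<^sub>C T x)"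

text \<open>Bounded linear maps from \<open>(V, p)\<close> to \<open>(W, q)\<close>; they are set to 0 off \<open>V\<close>, so that distinct
  functions are distinct operators.\<close>

definition bounded_maps :: "'a::complex_vector set \<Rightarrow> ('a \<Rightarrow> real) \<Rightarrow>
    'b::complex_vector set \<Rightarrow> ('b \<Rightarrow> real) \<Rightarrow> ('a \<Rightarrow> 'b) set"
  where "bounded_maps V p W q =
    {T. clinear_on V T \<and> (\<forall>x\<in>V. T x \<in> W) \<and> (\<forall>x. x \<notin> V \<longrightarrow> T x = 0) \<and>
        (\<exists>C. \<forall>x\<in>V. q (T x) \<le> C * p x)}"

definition map_norm :: "'a set \<Rightarrow> ('a \<Rightarrow> real) \<Rightarrow> ('b \<Rightarrow> real) \<Rightarrow> ('a \<Rightarrow> 'b) \<Rightarrow> real"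
  where "map_norm V p q T = (SUP x\<in>{x \<in> V. p x \<le> 1}. q (T x))"


section \<open>Operator spaces\<close>

text \<open>\<open>mnorm X n\<close> is the norm of \<open>M\<^sub>n(X)\<close>, for \<open>n \<ge> 1\<close>.\<close>

record 'a opspace =
  vecs :: "'a set"
  mnorm :: "nat \<Rightarrow> (nat \<Rightarrow> nat \<Rightarrow> 'a) \<Rightarrow> real"

definition vnorm :: "'a::zero opspace \<Rightarrow> 'a \<Rightarrow> real"
  where "vnorm X x = mnorm X 1 (\<lambda>i j. if i = 0 \<and> j = 0 then x else 0)"

definition dir_sum :: "nat \<Rightarrow> nat \<Rightarrow> (nat \<Rightarrow> nat \<Rightarrow> 'a::zero) \<Rightarrow> (nat \<Rightarrow> nat \<Rightarrow> 'a) \<Rightarrow> nat \<Rightarrow> nat \<Rightarrow> 'a"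
  where "dir_sum m n x y = (\<lambda>i j.
    if i < m \<and> j < m then x i j
    else if m \<le> i \<and> i < m + n \<and> m \<le> j \<and> j < m + n then y (i - m) (j - m) else 0)"

definition scalar_sandwich :: "nat \<Rightarrow> (nat \<Rightarrow> nat \<Rightarrow> complex) \<Rightarrow> (nat \<Rightarrow> nat \<Rightarrow> 'a::complex_vector) \<Rightarrow>
    (nat \<Rightarrow> nat \<Rightarrow> complex) \<Rightarrow> nat \<Rightarrow> nat \<Rightarrow> 'a"
  where "scalar_sandwich m \<alpha> x \<beta> = (\<lambda>i j. \<Sum>k<m. \<Sum>l<m. (\<alpha> i k * \<beta> l j) *\<^sub>C x k l)"

text \<open>Ruan's axioms.\<close>

definition operator_space :: "'a::complex_vector opspace \<Rightarrow> bool"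
  where "operator_space X \<longleftrightarrow>
    csubspace (vecs X) \<and>
    (\<forall>n\<ge>1. norm_on (matrices n n (vecs X)) (mnorm X n)) \<and>
    (\<forall>m\<ge>1. \<forall>n\<ge>1. \<forall>x\<in>matrices m m (vecs X). \<forall>y\<in>matrices n n (vecs X).
       mnorm X (m + n) (dir_sum m n x y) = max (mnorm X m x) (mnorm X n y)) \<and>
    (\<forall>m\<ge>1. \<forall>n\<ge>1. \<forall>x\<in>matrices m m (vecs X). \<forall>\<alpha>\<in>matrices n m UNIV. \<forall>\<beta>\<in>matrices m n UNIV.
       mnorm X n (scalar_sandwich m \<alpha> x \<beta>) \<le> op_norm n m \<alpha> * mnorm X m x * op_norm m n \<beta>)"

definition complete_space_on :: "'a::complex_vector set \<Rightarrow> ('a \<Rightarrow> real) \<Rightarrow> bool"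
  where "complete_space_on V p \<longleftrightarrow>
    (\<forall>s::nat \<Rightarrow> 'a. (\<forall>n. s n \<in> V) \<longrightarrow>
       (\<forall>e>0. \<exists>N. \<forall>m\<ge>N. \<forall>n\<ge>N. p (s m - s n) < e) \<longrightarrow>
       (\<exists>x\<in>V. (\<lambda>n. p (s n - x)) \<longlonglongrightarrow> 0))"

definition complete_operator_space :: "'a::complex_vector opspace \<Rightarrow> bool"
  where "complete_operator_space X \<longleftrightarrow> operator_space X \<and> complete_space_on (vecs X) (vnorm X)"

definition dual :: "'a::complex_vector opspace \<Rightarrow> ('a \<Rightarrow> complex) set"
  where "dual X = bounded_maps (vecs X) (vnorm X) UNIV cmod"

definition dual_norm :: "'a::complex_vector opspace \<Rightarrow> ('a \<Rightarrow> complex) \<Rightarrow> real"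
  where "dual_norm X = map_norm (vecs X) (vnorm X) cmod"

definition dual_ball :: "'a::complex_vector opspace \<Rightarrow> ('a \<Rightarrow> complex) set"
  where "dual_ball X = {x' \<in> dual X. dual_norm X x' \<le> 1}"

text \<open>\<open>M\<^sub>d\<close>, with \<open>M\<^sub>n(M\<^sub>d)\<close> normed as \<open>M\<^bsub>nd\<^esub>\<close> by reading \<open>A\<close> as a block matrix.\<close>

definition mat_opspace :: "nat \<Rightarrow> (nat \<Rightarrow> nat \<Rightarrow> complex) opspace"
  where "mat_opspace d = \<lparr> vecs = matrices d d UNIV,
    mnorm = (\<lambda>n A. op_norm (n * d) (n * d) (\<lambda>r s. A (r div d) (s div d) (r mod d) (s mod d))) \<rparr>"

definition linf_sum :: "'i set \<Rightarrow> ('i \<Rightarrow> 'a::zero opspace) \<Rightarrow> ('i \<Rightarrow> 'a) opspace"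
  where "linf_sum I Y = \<lparr>
    vecs = {F. (\<forall>c\<in>I. F c \<in> vecs (Y c)) \<and> (\<forall>c. c \<notin> I \<longrightarrow> F c = 0) \<and>
               bdd_above ((\<lambda>c. vnorm (Y c) (F c)) ` I)},
    mnorm = (\<lambda>n F. SUP c\<in>I. mnorm (Y c) n (\<lambda>i j. F i j c)) \<rparr>"

text \<open>\<open>\<B>(X', W)\<close>, where \<open>M\<^sub>n(\<B>(X', W))\<close> is normed as \<open>\<B>(X', M\<^sub>n(W))\<close>.\<close>

definition dual_maps :: "'a::complex_vector opspace \<Rightarrow> 'b::complex_vector opspace \<Rightarrow>
    (('a \<Rightarrow> complex) \<Rightarrow> 'b) opspace"
  where "dual_maps X W = \<lparr>
    vecs = bounded_maps (dual X) (dual_norm X) (vecs W) (vnorm W),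
    mnorm = (\<lambda>n T. map_norm (dual X) (dual_norm X) (mnorm W n) (\<lambda>x' i j. T i j x')) \<rparr>"

text \<open>The norms of the amplifications are taken in \<open>ereal\<close>, so that the suprema are genuine.\<close>

definition completely_bounded ::
    "'a::complex_vector opspace \<Rightarrow> 'b::complex_vector opspace \<Rightarrow> ('a \<Rightarrow> 'b) \<Rightarrow> bool"
  where "completely_bounded V W \<phi> \<longleftrightarrow>
    clinear_on (vecs V) \<phi> \<and> (\<forall>x\<in>vecs V. \<phi> x \<in> vecs W) \<and>
    (SUP n\<in>{1..}. SUP x\<in>{x \<in> matrices n n (vecs V). mnorm V n x \<le> 1}.
       ereal (mnorm W n (\<lambda>i j. \<phi> (x i j)))) < \<infinity>"


section \<open>Haar measure and vector measures\<close>

text \<open>The group is written additively, because this is the library's class of topological groups;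
  \<^class>\<open>group_add\<close> does not include commutativity. Normalized Haar measure is the unique regular
  translation-invariant Borel probability measure.\<close>

definition normalized_haar :: "'g::{topological_group_add, t2_space} measure \<Rightarrow> bool"
  where "normalized_haar m \<longleftrightarrow>
    sets m = sets borel \<and> emeasure m UNIV = 1 \<and>
    (\<forall>g. \<forall>A\<in>sets borel. emeasure m ((\<lambda>t. g + t) ` A) = emeasure m A) \<and>
    (\<forall>A\<in>sets borel. emeasure m A = (SUP K\<in>{K. compact K \<and> K \<subseteq> A}. emeasure m K)) \<and>
    (\<forall>A\<in>sets borel. emeasure m A = (INF U\<in>{U. open U \<and> A \<subseteq> U}. emeasure m U))"

definition Mac :: "'g::topological_space measure \<Rightarrow> 'x::complex_vector opspace \<Rightarrow> ('g set \<Rightarrow> 'x) set"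
  where "Mac m X = {\<nu>.
    (\<forall>A\<in>sets borel. \<nu> A \<in> vecs X) \<and>
    (\<forall>A::nat \<Rightarrow> 'g set. range A \<subseteq> sets borel \<longrightarrow> disjoint_family A \<longrightarrow>
       (\<lambda>n. vnorm X ((\<Sum>k<n. \<nu> (A k)) - \<nu> (\<Union>k. A k))) \<longlonglongrightarrow> 0) \<and>
    (\<forall>e>0. \<exists>\<delta>>0. \<forall>A\<in>sets borel. measure m A < \<delta> \<longrightarrow> vnorm X (\<nu> A) < e)}"

definition total_variation :: "('g::topological_space set \<Rightarrow> complex) \<Rightarrow> 'g measure"
  where "total_variation \<mu> = measure_of UNIV (sets borel)
    (\<lambda>A. SUP P\<in>{P. finite P \<and> partition_on A P \<and> P \<subseteq> sets borel}. \<Sum>B\<in>P. ennreal (cmod (\<mu> B)))"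

text \<open>Radon--Nikodym derivative of a complex measure; it is unique up to \<open>m\<close>-null sets.\<close>

definition rn_derivative :: "'g measure \<Rightarrow> ('g set \<Rightarrow> complex) \<Rightarrow> 'g \<Rightarrow> complex"
  where "rn_derivative m \<mu> =
    (SOME h. integrable m h \<and> (\<forall>A\<in>sets m. \<mu> A = set_lebesgue_integral m A h))"

definition scalar_meas :: "('g set \<Rightarrow> 'x) \<Rightarrow> ('x \<Rightarrow> complex) \<Rightarrow> 'g set \<Rightarrow> complex"
  where "scalar_meas \<nu> x' = (\<lambda>A. x' (\<nu> A))"

definition weak_norm :: "'x::complex_vector opspace \<Rightarrow> ('g::topological_space set \<Rightarrow> 'x) \<Rightarrow>
    ('g \<Rightarrow> complex) \<Rightarrow> real"
  where "weak_norm X \<nu> f =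
    (SUP x'\<in>dual_ball X. \<integral>t. cmod (f t) \<partial>(total_variation (scalar_meas \<nu> x')))"

text \<open>As usual for integrable functions in the library, the elements of \<open>L\<^sup>1\<^sub>w(\<nu>)\<close> are functions
  rather than classes modulo \<open>\<nu>\<close>-null functions, so its matrix norms are seminorms. A linear map
  bounded for these seminorms, into a space whose norm is definite, vanishes on the functions of
  seminorm 0 and hence is a map on the classes, of the same norm.\<close>

definition L1w :: "'x::complex_vector opspace \<Rightarrow> ('g::topological_space set \<Rightarrow> 'x) \<Rightarrow>
    ('g \<Rightarrow> complex) opspace"
  where "L1w X \<nu> = \<lparr>
    vecs = {f. \<forall>x'\<in>dual X. integrable (total_variation (scalar_meas \<nu> x')) f},
    mnorm = (\<lambda>n f. SUP y'\<in>dual_ball (mat_opspace n). weak_norm X \<nu> (\<lambda>t. y' (\<lambda>i j. f i j t))) \<rparr>"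


section \<open>The dual object and the Fourier transform\<close>

text \<open>A representation is given in matrix form, with respect to an orthonormal basis, as a pair
  \<open>(d, \<pi>)\<close>; irreducible unitary representations of compact groups are finite-dimensional.\<close>

type_synonym 'g mat_rep = "nat \<times> ('g \<Rightarrow> nat \<Rightarrow> nat \<Rightarrow> complex)"

definition unitary_rep :: "'g::topological_group_add mat_rep \<Rightarrow> bool"
  where "unitary_rep R \<longleftrightarrow> (case R of (d, \<pi>) \<Rightarrow>
    (\<forall>t. unitary_mat d (\<pi> t)) \<and>
    (\<forall>s t. \<pi> (s + t) = mat_mult d (\<pi> s) (\<pi> t)) \<and>
    (\<forall>i j. continuous_on UNIV (\<lambda>t. \<pi> t i j)))"

definition irreducible_rep :: "'g mat_rep \<Rightarrow> bool"
  where "irreducible_rep R \<longleftrightarrow> (case R of (d, \<pi>) \<Rightarrow>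
    d \<ge> 1 \<and>
    (\<forall>S. csubspace S \<longrightarrow> S \<subseteq> {v. \<forall>i\<ge>d. v i = 0} \<longrightarrow> (\<forall>t. \<forall>v\<in>S. mat_vec d (\<pi> t) v \<in> S) \<longrightarrow>
         S = {0} \<or> S = {v. \<forall>i\<ge>d. v i = 0}))"

definition irreps :: "'g::topological_group_add mat_rep set"
  where "irreps = {R. unitary_rep R \<and> irreducible_rep R}"

definition rep_equiv :: "('g::topological_group_add mat_rep \<times> 'g mat_rep) set"
  where "rep_equiv = {((d, \<pi>), (e, \<rho>)). (d, \<pi>) \<in> irreps \<and> (e, \<rho>) \<in> irreps \<and> d = e \<and>
    (\<exists>U. unitary_mat d U \<and> (\<forall>t. mat_mult d U (\<pi> t) = mat_mult d (\<rho> t) U))}"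

definition dual_object :: "'g::topological_group_add mat_rep set set"
  where "dual_object = irreps // rep_equiv"

definition fourier_coeff :: "'g measure \<Rightarrow> ('g \<Rightarrow> complex) \<Rightarrow> 'g mat_rep \<Rightarrow> nat \<Rightarrow> nat \<Rightarrow> complex"
  where "fourier_coeff m g R = (case R of (d, \<pi>) \<Rightarrow>
    (\<lambda>i j. if i < d \<and> j < d then 1 / of_nat d * (\<integral>t. g t * mat_adj (\<pi> t) i j \<partial>m) else 0))"

text \<open>\<open>rep\<close> chooses the representative of each class; the transform is 0 off the dual and off the
  dual object, as the carriers above require.\<close>

definition fourier_transform :: "'g::topological_group_add measure \<Rightarrow> 'x::complex_vector opspace \<Rightarrow>
    ('g set \<Rightarrow> 'x) \<Rightarrow> ('g mat_rep set \<Rightarrow> 'g mat_rep) \<Rightarrow> ('g \<Rightarrow> complex) \<Rightarrow>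
    ('x \<Rightarrow> complex) \<Rightarrow> 'g mat_rep set \<Rightarrow> nat \<Rightarrow> nat \<Rightarrow> complex"
  where "fourier_transform m X \<nu> rep f = (\<lambda>x' c.
    if x' \<in> dual X \<and> c \<in> dual_object
    then fourier_coeff m (\<lambda>t. f t * rn_derivative m (scalar_meas \<nu> x') t) (rep c) else 0)"

definition fourier_range :: "('g::topological_group_add mat_rep set \<Rightarrow> 'g mat_rep) \<Rightarrow>
    ('g mat_rep set \<Rightarrow> nat \<Rightarrow> nat \<Rightarrow> complex) opspace"
  where "fourier_range rep = linf_sum dual_object (\<lambda>c. mat_opspace (fst (rep c)))"

end

theory Submission
  imports Defs
begin

text \<open>Write \<open>h x'\<close> for the density of the scalar measure \<open>\<langle>\<nu>, x'\<rangle>\<close>. Since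
\<open>d|\<langle>\<nu>, x'\<rangle>| = |h x'| dm\<close>, the transform, which takes the Fourier coefficients of
\<open>f h x'\<close>, and the norm of \<open>f\<close> both are given by integrals over \<open>m\<close>. Two things have to be shown: that the suprema which define the norms
are finite, and that passing to matrices costs nothing.

\<^bold>\<open>Finiteness.\<close> A weakly integrable \<open>f\<close> satisfies \<open>\<integral> |f| d|\<langle>\<nu>, x'\<rangle>| < \<infinity>\<close> for every single
\<open>x'\<close>; the norm of \<open>f\<close> is a supremum over the unit ball of \<open>X'\<close>. The function
\<open>x' \<mapsto> \<integral> |f| d|\<langle>\<nu>, x'\<rangle>|\<close> is a pointwise supremum of the seminorms
\<open>x' \<mapsto> \<integral> min |f| k |h x'| dm\<close>, and \<open>X'\<close> is complete, so the uniform boundedness principle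
(\<open>uniform_boundedness\<close>) gives a bound \<open>C * \<parallel>x'\<parallel>\<close> as soon as each of these seminorms is bounded.
The latter needs \<open>\<integral> |h x'| dm \<le> K * \<parallel>x'\<parallel>\<close>, which follows from the boundedness of the range of a
countably additive vector measure (\<open>bounded_range\<close>). Boundedness of the range also feeds the
Jordan decomposition behind the existence of \<open>h x'\<close> (\<open>complex_measure_density\<close>) and thus the
formula for the total variation (\<open>total_variation_eq_density\<close>).

\<^bold>\<open>Matrices.\<close> The matrix norms of \<open>L\<^sup>1\<^sub>w(\<nu>)\<close> are those of a minimal operator space: they only
see scalar functions \<open>\<langle>F, y'\<rangle>\<close> with \<open>y'\<close> a functional on \<open>M\<^sub>n\<close>. A bounded map from such a space
to \<open>M\<^sub>d\<close> is completely bounded with constant at most \<open>d\<close> times its norm. The reason is elementary: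
a matrix of \<open>d \<times> d\<close> blocks of norm at most \<open>K\<close> has norm at most \<open>d K\<close> (\<open>op_norm_blocks_le\<close>).
Here the blocks are indexed like the entries of \<open>\<pi>(t)\<^sup>*\<close>, which have modulus at most 1 because \<open>\<pi>(t)\<close>
is unitary, and the block at \<open>(k, l)\<close> is \<open>1/d \<integral> F h x' (\<pi>(t)\<^sup>*)\<^sub>k\<^sub>l dm\<close>. Tested against unit
vectors \<open>w\<close> and \<open>v\<close> it is at most \<open>1/d \<integral> |\<langle>F v, w\<rangle>| |h x'| dm\<close>, so for \<open>x'\<close> in the unit ball
\<open>K\<close> is \<open>1/d\<close> times the norm of \<open>F\<close>, and the normalizing factor \<open>1/d\<close> of the Fourier coefficients cancels the \<open>d\<close> from the
blocks (\<open>op_norm_fourier_coeff_le\<close>). Therefore all amplifications are contractions. The bound on a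
single \<open>f\<close> is the case of \<open>1 \<times> 1\<close> matrices.\<close>

section \<open>Seminorms, bounded functionals and uniform boundedness\<close>

text \<open>Uniform boundedness is applied to functions such as \<open>x' \<mapsto> \<integral> g d|\<langle>\<nu>, x'\<rangle>|\<close>, which may
vanish at nonzero points.\<close>

definition seminorm_on :: "'a::complex_vector set \<Rightarrow> ('a \<Rightarrow> real) \<Rightarrow> bool"
  where "seminorm_on V p \<longleftrightarrow>
    (\<forall>x\<in>V. 0 \<le> p x) \<and>
    (\<forall>x\<in>V. \<forall>y\<in>V. p (x + y) \<le> p x + p y) \<and>
    (\<forall>a. \<forall>x\<in>V. p (a *\<^sub>C x) = cmod a * p x)"

lemma norm_on_imp_seminorm_on: "norm_on V p \<Longrightarrow> seminorm_on V p"
  by (auto simp: norm_on_def seminorm_on_def)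

lemma seminorm_onD:
  assumes "seminorm_on V p"
  shows "x \<in> V \<Longrightarrow> 0 \<le> p x"
    and "x \<in> V \<Longrightarrow> y \<in> V \<Longrightarrow> p (x + y) \<le> p x + p y"
    and "x \<in> V \<Longrightarrow> p (a *\<^sub>C x) = cmod a * p x"
    and "x \<in> V \<Longrightarrow> p (- x) = p x"
    and "x \<in> V \<Longrightarrow> p 0 = 0"
proof -
  show "x \<in> V \<Longrightarrow> 0 \<le> p x" and "x \<in> V \<Longrightarrow> y \<in> V \<Longrightarrow> p (x + y) \<le> p x + p y"
    and h: "\<And>a. x \<in> V \<Longrightarrow> p (a *\<^sub>C x) = cmod a * p x"
    using assms unfolding seminorm_on_def by blast+
  show "x \<in> V \<Longrightarrow> p (- x) = p x"
    using h[of "-1"] by simp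
  show "x \<in> V \<Longrightarrow> p 0 = 0"
    using h[of 0] by simp
qed

lemma seminorm_on_diff:
  assumes "seminorm_on V p" "csubspace V" "x \<in> V" "y \<in> V"
  shows "p (x - y) \<le> p x + p y"
  using seminorm_onD(2)[OF assms(1,3), of "- y"] seminorm_onD(4)[OF assms(1,4)]
    complex_vector.subspace_neg[OF assms(2,4)] by simp

lemma bdd_above_map_norm:
  fixes p :: "'a \<Rightarrow> real" and q :: "'b \<Rightarrow> real"
  assumes "\<exists>C. \<forall>x\<in>V. q (T x) \<le> C * p x" "\<forall>x\<in>V. 0 \<le> p x"
  shows "bdd_above ((\<lambda>x. q (T x)) ` {x \<in> V. p x \<le> 1})"
proof -
  obtain C where C: "\<forall>x\<in>V. q (T x) \<le> C * p x" using assms by blast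
  have "q (T x) \<le> \<bar>C\<bar>" if "x \<in> V" "p x \<le> 1" for x
  proof -
    have "q (T x) \<le> C * p x" using C that by blast
    also have "\<dots> \<le> \<bar>C\<bar> * p x" using assms that by (intro mult_right_mono) auto
    also have "\<dots> \<le> \<bar>C\<bar>" using that by (intro mult_left_le) auto
    finally show ?thesis .
  qed
  then show ?thesis by (intro bdd_aboveI2) auto
qed

text \<open>Rescaling to the unit ball uses homogeneity of \<open>x \<mapsto> q (T x)\<close>. In this form the lemma covers
the weak norm, a \<open>map_norm\<close> in which \<open>T x' = \<integral> |f| d|\<langle>\<nu>, x'\<rangle>|\<close> is homogeneous without being linear.
Points where \<open>p\<close> vanishes cannot be rescaled; the boundedness hypothesis covers them.\<close>

lemma le_map_norm:
  assumes V: "csubspace V" and p: "seminorm_on V p"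
    and hom: "\<And>a x. x \<in> V \<Longrightarrow> q (T (a *\<^sub>C x)) = cmod a * q (T x)"
    and bd: "\<exists>C. \<forall>x\<in>V. q (T x) \<le> C * p x" and x: "x \<in> V"
  shows "q (T x) \<le> map_norm V p q T * p x"
proof (cases "p x = 0")
  case True
  obtain C where "\<forall>x\<in>V. q (T x) \<le> C * p x" using bd by blast
  with x have "q (T x) \<le> C * p x" by blast
  with True show ?thesis by simp
next
  case False
  have pos: "p x > 0" using False seminorm_onD(1)[OF p x] by linarith
  let ?u = "complex_of_real (1 / p x) *\<^sub>C x"
  have u: "?u \<in> V" using V x by (rule complex_vector.subspace_scale)
  have "p ?u = 1"
    using pos by (subst seminorm_onD(3)[OF p x]) (simp add: norm_divide)
  then have "q (T ?u) \<le> map_norm V p q T"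
    unfolding map_norm_def using u seminorm_onD(1)[OF p]
    by (intro cSUP_upper bdd_above_map_norm[where q=q and T=T and p=p, OF bd]) auto
  then show ?thesis
    unfolding hom[OF x] using pos by (simp add: norm_divide divide_simps)
qed

lemma map_norm_le:
  fixes q :: "'b \<Rightarrow> real"
  assumes "csubspace V" "seminorm_on V p" "0 \<le> C" "\<And>x. x \<in> V \<Longrightarrow> q (T x) \<le> C * p x"
  shows "map_norm V p q T \<le> C"
  unfolding map_norm_def
proof (rule cSUP_least)
  have "0 \<in> V" using assms(1) by (rule complex_vector.subspace_0)
  moreover from this have "p 0 = 0" by (rule seminorm_onD(5)[OF assms(2)])
  ultimately have "0 \<in> {x \<in> V. p x \<le> 1}" by simp
  then show "{x \<in> V. p x \<le> 1} \<noteq> {}" by blast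
  show "q (T x) \<le> C" if "x \<in> {x \<in> V. p x \<le> 1}" for x
  proof -
    have "q (T x) \<le> C * p x" using that assms(4) by blast
    also have "\<dots> \<le> C" using that assms(3) by (intro mult_left_le) auto
    finally show ?thesis .
  qed
qed

lemma map_norm_nonneg:
  fixes q :: "'b \<Rightarrow> real"
  assumes "csubspace V" "seminorm_on V p" "q (T 0) = 0" "\<exists>C. \<forall>x\<in>V. q (T x) \<le> C * p x"
  shows "0 \<le> map_norm V p q T"
proof -
  have 0: "0 \<in> V" using assms(1) by (rule complex_vector.subspace_0)
  have "q (T 0) \<le> map_norm V p q T"
    unfolding map_norm_def using 0 seminorm_onD(5)[OF assms(2) 0] seminorm_onD(1)[OF assms(2)]
    by (intro cSUP_upper bdd_above_map_norm[where q=q and T=T and p=p, OF assms(4)]) auto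
  then show ?thesis using assms by simp
qed

text \<open>The proof constructs a point directly instead of invoking Baire's theorem. If the conclusion
fails, there are \<open>q\<^sub>n\<close> in the family of norm at least \<open>4\<^sup>n\<close> and vectors \<open>u\<^sub>n\<close> of the unit ball which almost
attain these norms. Walk from 0 by steps \<open>\<plusminus> 3\<^sup>-\<^sup>n u\<^sub>n\<close>, choosing the sign such that \<open>q\<^sub>n\<close> is at least
\<open>3\<^sup>-\<^sup>n q\<^sub>n u\<^sub>n\<close> after the step. All later steps together move the point by at most half of \<open>3\<^sup>-\<^sup>n\<close>,
which cannot undo this, so that \<open>q\<^sub>n\<close> is of order \<open>(4/3)\<^sup>n\<close> at the limit.\<close>

lemma uniform_boundedness:
  assumes V: "csubspace V" and N: "seminorm_on V N" and complete: "complete_space_on V N"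
    and q: "\<And>i. i \<in> I \<Longrightarrow> seminorm_on V (q i)"
    and cont: "\<And>i. i \<in> I \<Longrightarrow> \<exists>C. \<forall>x\<in>V. q i x \<le> C * N x"
    and ptw: "\<And>x. x \<in> V \<Longrightarrow> \<exists>B. \<forall>i\<in>I. q i x \<le> B"
  shows "\<exists>C. \<forall>i\<in>I. \<forall>x\<in>V. q i x \<le> C * N x"
proof (rule ccontr)
  assume no: "\<not> ?thesis"
  have "\<exists>i u. i \<in> I \<and> u \<in> V \<and> N u \<le> 1 \<and> 4 ^ n \<le> q i u \<and>
      (\<forall>y\<in>V. q i y \<le> 3/2 * q i u * N y)" for n :: nat
  proof -
    obtain i x where i: "i \<in> I" and x: "x \<in> V" and big: "q i x > (3/2 * 4 ^ n) * N x"
      using no by (meson not_le)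
    define S where "S = map_norm V N (q i) (\<lambda>x. x)"
    have S: "q i y \<le> S * N y" if "y \<in> V" for y
      unfolding S_def
      using le_map_norm[OF V N, of "q i" "\<lambda>x. x"] seminorm_onD(3)[OF q[OF i]] cont[OF i] that by auto
    have "N x \<ge> 0" using seminorm_onD(1)[OF N x] .
    moreover have "(3/2 * 4 ^ n) * N x < S * N x" using S[OF x] big by linarith
    ultimately have S1: "3/2 * 4 ^ n < S" by (meson mult_right_mono not_le)
    have "0 < 3/2 * (4::real) ^ n" by simp
    then have "2/3 * S < S" using S1 by linarith
    moreover have "{x \<in> V. N x \<le> 1} \<noteq> {}"
      using complex_vector.subspace_0[OF V] seminorm_onD(5)[OF N] by force
    ultimately obtain u where u: "u \<in> V" "N u \<le> 1" "2/3 * S < q i u"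
      using cont[OF i] N less_cSUP_iff[of "{x \<in> V. N x \<le> 1}" "\<lambda>x. q i x" "2/3 * S"]
        bdd_above_map_norm[of V "q i" "\<lambda>x. x" N]
      unfolding S_def map_norm_def by (auto simp: seminorm_on_def)
    have "q i y \<le> 3/2 * q i u * N y" if "y \<in> V" for y
    proof -
      have "S * N y \<le> (3/2 * q i u) * N y"
        using u seminorm_onD(1)[OF N that] by (intro mult_right_mono) auto
      with S[OF that] show ?thesis by linarith
    qed
    with i u S1 show ?thesis by (intro exI[of _ i] exI[of _ u]) auto
  qed
  then obtain i u where i: "\<And>n. i n \<in> I" and u: "\<And>n. u n \<in> V" and Nu: "\<And>n. N (u n) \<le> 1"
    and big: "\<And>n. 4 ^ n \<le> q (i n) (u n)"
    and near: "\<And>n y. y \<in> V \<Longrightarrow> q (i n) y \<le> 3/2 * q (i n) (u n) * N y"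
    by metis
  define d where "d n = complex_of_real ((1/3) ^ n) *\<^sub>C u n" for n
  have dV: "d n \<in> V" for n unfolding d_def using V u by (simp add: complex_vector.subspace_scale)
  have qd: "q (i n) (d n) = (1/3) ^ n * q (i n) (u n)" for n
    unfolding d_def by (subst seminorm_onD(3)[OF q[OF i] u]) (simp add: norm_power norm_divide power_one_over)
  have Nd: "N (d n) \<le> (1/3) ^ n" for n
    unfolding d_def using Nu[of n] seminorm_onD(1)[OF N u]
    by (subst seminorm_onD(3)[OF N u]) (simp add: norm_power norm_divide power_one_over divide_right_mono)
  define x where "x = rec_nat 0 (\<lambda>n y. if q (i n) (d n) \<le> q (i n) (y + d n) then y + d n else y - d n)"
  have xSuc: "x (Suc n) = (if q (i n) (d n) \<le> q (i n) (x n + d n) then x n + d n else x n - d n)" for n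
    by (simp add: x_def)
  have xV: "x n \<in> V" for n
  proof (induction n)
    case 0 then show ?case using V by (simp add: x_def complex_vector.subspace_0)
  next
    case (Suc n) then show ?case
      using V dV by (simp add: xSuc complex_vector.subspace_add complex_vector.subspace_diff)
  qed
  have qx: "q (i n) (d n) \<le> q (i n) (x (Suc n))" for n
  proof (cases "q (i n) (d n) \<le> q (i n) (x n + d n)")
    case False
    (* one of the two points x n + d n, x n - d n must be far out, as their difference is 2 d n *)
    have "2 * q (i n) (d n) = q (i n) (2 *\<^sub>C d n)"
      using seminorm_onD(3)[OF q[OF i] dV, of n 2] by simp
    also have "2 *\<^sub>C d n = (x n + d n) - (x n - d n)"
      using scaleC_add_left[of 1 1 "d n"] by (simp add: scaleC_one)
    also have "q (i n) \<dots> \<le> q (i n) (x n + d n) + q (i n) (x n - d n)"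
      using V xV dV by (intro seminorm_on_diff[OF q[OF i] V])
        (auto simp: complex_vector.subspace_add complex_vector.subspace_diff)
    finally show ?thesis using False by (simp add: xSuc)
  qed (simp add: xSuc)
  have tail: "N (x (n + k) - x n) \<le> 3/2 * ((1/3) ^ n - (1/3) ^ (n + k))" for n k
  proof (induction k)
    case 0 then show ?case using seminorm_onD(5)[OF N xV] by simp
  next
    case (Suc k)
    define e where "e = x (Suc (n + k)) - x (n + k)"
    have e: "e = d (n + k) \<or> e = - d (n + k)" by (auto simp: e_def xSuc)
    then have eV: "e \<in> V" using V dV complex_vector.subspace_neg by metis
    have "N e \<le> (1/3) ^ (n + k)" using e Nd[of "n + k"] seminorm_onD(4)[OF N dV] by metis
    moreover have "N (e + (x (n + k) - x n)) \<le> N e + N (x (n + k) - x n)"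
      using V xV eV by (intro seminorm_onD(2)[OF N]) (auto simp: complex_vector.subspace_diff)
    ultimately show ?case using Suc by (simp add: e_def)
  qed
  have tail2: "N (x l - x n) \<le> 3/2 * (1/3) ^ n" if "n \<le> l" for l n
  proof -
    have "N (x l - x n) \<le> 3/2 * ((1/3) ^ n - (1/3) ^ l)"
      using tail[of n "l - n"] that by simp
    also have "\<dots> \<le> 3/2 * (1/3) ^ n" by simp
    finally show ?thesis .
  qed
  have lim3: "(\<lambda>n. 3 * (1/3 :: real) ^ n) \<longlonglongrightarrow> 0"
    by (intro tendsto_mult_right_zero LIMSEQ_realpow_zero) auto
  have "\<exists>M. \<forall>m\<ge>M. \<forall>n\<ge>M. N (x m - x n) < e" if e: "e > 0" for e
  proof -
    obtain M where M: "3 * (1/3) ^ M < e"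
      using order_tendstoD(2)[OF lim3 e] by (auto simp: eventually_sequentially)
    have "N (x m - x n) < e" if "m \<ge> M" "n \<ge> M" for m n
    proof -
      have "N (x m - x n) \<le> N (x m - x M) + N (x n - x M)"
        using seminorm_on_diff[OF N V, of "x m - x M" "x n - x M"] V xV
        by (simp add: complex_vector.subspace_diff)
      with tail2[OF that(1)] tail2[OF that(2)] M show ?thesis by linarith
    qed
    then show ?thesis by blast
  qed
  with complete xV obtain z where z: "z \<in> V" and lim: "(\<lambda>n. N (x n - z)) \<longlonglongrightarrow> 0"
    unfolding complete_space_on_def by blast
  have close: "N (z - x n) \<le> 3/2 * (1/3) ^ n" for n
  proof (rule LIMSEQ_le_const)
    show "(\<lambda>l. N (x l - z) + 3/2 * (1/3) ^ n) \<longlonglongrightarrow> 3/2 * (1/3) ^ n"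
      using tendsto_add[OF lim tendsto_const] by simp
    have "N (z - x n) \<le> N (x l - z) + 3/2 * (1/3) ^ n" if "l \<ge> n" for l
    proof -
      have "N (z - x n) \<le> N (x l - x n) + N (x l - z)"
        using seminorm_on_diff[OF N V, of "x l - x n" "x l - z"] V xV z
        by (simp add: complex_vector.subspace_diff)
      with tail2[OF that] show ?thesis by linarith
    qed
    then show "\<exists>M. \<forall>l\<ge>M. N (z - x n) \<le> N (x l - z) + 3/2 * (1/3) ^ n" by blast
  qed
  (* the remaining steps cost at most 3/2 * 1/2 = 3/4 of the gain of step n *)
  have grow: "1/4 * (4/3) ^ n \<le> q (i n) z" for n
  proof -
    have D: "z - x (Suc n) \<in> V" using V z xV by (simp add: complex_vector.subspace_diff)
    have pos: "0 \<le> q (i n) (u n)" using big[of n] by (meson order_trans zero_le_power zero_le_numeral)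
    have "q (i n) (x (Suc n)) \<le> q (i n) z + q (i n) (z - x (Suc n))"
      using seminorm_on_diff[OF q[OF i] V z D] by simp
    moreover have "q (i n) (z - x (Suc n)) \<le> 3/2 * q (i n) (u n) * (3/2 * (1/3) ^ Suc n)"
      using near[OF D, of n] mult_left_mono[OF close[of "Suc n"], of "3/2 * q (i n) (u n)"] pos
      by linarith
    moreover have "3/2 * q (i n) (u n) * (3/2 * (1/3) ^ Suc n) = 3/4 * ((1/3) ^ n * q (i n) (u n))"
      by simp
    ultimately have "q (i n) z \<ge> 1/4 * ((1/3) ^ n * q (i n) (u n))"
      using qx[of n] qd[of n] by linarith
    moreover have "1/4 * (1/3) ^ n * 4 ^ n \<le> 1/4 * (1/3) ^ n * q (i n) (u n)"
      using big[of n] by (intro mult_left_mono) auto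
    moreover have "(1/3 :: real) ^ n * 4 ^ n = (4/3) ^ n"
      by (simp flip: power_mult_distrib)
    ultimately show ?thesis by (simp add: mult.assoc)
  qed
  obtain B where "\<forall>j\<in>I. q j z \<le> B" using ptw[OF z] by blast
  then have B: "1/4 * (4/3) ^ n \<le> B" for n :: nat using grow[of n] i[of n] by force
  obtain n where "(4/3 :: real) ^ n > 4 * B" using real_arch_pow[of "4/3" "4 * B"] by auto
  with B[of n] show False by simp
qed

lemma csubspace_bounded_maps:
  assumes V: "csubspace V" and p: "seminorm_on V p"
  shows "csubspace (bounded_maps V p UNIV cmod)"
proof (rule complex_vector.subspaceI)
  show "0 \<in> bounded_maps V p UNIV cmod"
    by (auto simp: bounded_maps_def clinear_on_def intro: exI[of _ 0])
  show "S + T \<in> bounded_maps V p UNIV cmod"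
    if ST: "S \<in> bounded_maps V p UNIV cmod" "T \<in> bounded_maps V p UNIV cmod" for S T
  proof -
    obtain C where "\<forall>x\<in>V. cmod (S x) \<le> C * p x"
      using ST(1) unfolding bounded_maps_def by blast
    moreover obtain D where "\<forall>x\<in>V. cmod (T x) \<le> D * p x"
      using ST(2) unfolding bounded_maps_def by blast
    ultimately have "\<forall>x\<in>V. cmod ((S + T) x) \<le> (C + D) * p x"
      by (auto simp: distrib_right intro!: norm_triangle_le add_mono)
    then have "\<exists>C. \<forall>x\<in>V. cmod ((S + T) x) \<le> C * p x" by blast
    then show ?thesis using ST
      by (auto simp: bounded_maps_def clinear_on_def scaleC_add_right scaleC_complex_def algebra_simps)
  qed
  show "a *\<^sub>C T \<in> bounded_maps V p UNIV cmod" if T: "T \<in> bounded_maps V p UNIV cmod" for a T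
  proof -
    obtain D where "\<forall>x\<in>V. cmod (T x) \<le> D * p x"
      using T unfolding bounded_maps_def by blast
    then have "\<forall>x\<in>V. cmod ((a *\<^sub>C T) x) \<le> (cmod a * D) * p x"
      by (auto simp: scaleC_fun_def scaleC_complex_def norm_mult mult.assoc intro!: mult_left_mono)
    then have "\<exists>C. \<forall>x\<in>V. cmod ((a *\<^sub>C T) x) \<le> C * p x" by blast
    then show ?thesis using T
      by (auto simp: bounded_maps_def clinear_on_def scaleC_fun_def scaleC_complex_def algebra_simps)
  qed
qed

lemma functional_le:
  assumes "csubspace V" "seminorm_on V p" "T \<in> bounded_maps V p UNIV cmod" "x \<in> V"
  shows "cmod (T x) \<le> map_norm V p cmod T * p x"
  using assms by (intro le_map_norm)
    (auto simp: bounded_maps_def clinear_on_def scaleC_complex_def norm_mult)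

lemma seminorm_on_bounded_maps:
  assumes V: "csubspace V" and p: "seminorm_on V p"
  shows "seminorm_on (bounded_maps V p UNIV cmod) (map_norm V p cmod)"
proof -
  let ?B = "bounded_maps V p UNIV cmod" and ?N = "map_norm V p cmod"
  have T0: "T 0 = 0" if "T \<in> ?B" for T
  proof -
    have "T (0 *\<^sub>C 0) = 0 *\<^sub>C T 0"
      using that complex_vector.subspace_0[OF V] by (simp only: bounded_maps_def clinear_on_def) blast
    then show ?thesis by simp
  qed
  have nonneg: "0 \<le> ?N T" if "T \<in> ?B" for T
    using that T0[OF that] by (intro map_norm_nonneg[OF V p]) (auto simp: bounded_maps_def)
  have scale: "?N (a *\<^sub>C T) \<le> cmod a * ?N T" if "T \<in> ?B" for a T
    using nonneg[OF that] functional_le[OF V p that]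
    by (intro map_norm_le[OF V p])
      (auto simp: scaleC_fun_def scaleC_complex_def norm_mult mult.assoc intro!: mult_left_mono)
  have "?N (a *\<^sub>C T) = cmod a * ?N T" if T: "T \<in> ?B" for a T
  proof (cases "a = 0")
    case True
    with scale[OF T, of a] nonneg[of "0 *\<^sub>C T"] T csubspace_bounded_maps[OF V p] show ?thesis
      by (auto dest: complex_vector.subspace_0)
  next
    case False
    have "a *\<^sub>C T \<in> ?B" using csubspace_bounded_maps[OF V p] T by (rule complex_vector.subspace_scale)
    from scale[OF this, of "inverse a"] False have "?N T \<le> inverse (cmod a) * ?N (a *\<^sub>C T)"
      by (simp add: scaleC_scaleC scaleC_one norm_inverse)
    with scale[OF T, of a] False show ?thesis by (simp add: field_simps)
  qed
  moreover have "?N (S + T) \<le> ?N S + ?N T" if "S \<in> ?B" "T \<in> ?B" for S T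
    using nonneg that functional_le[OF V p]
    by (intro map_norm_le[OF V p]) (auto simp: distrib_right intro!: norm_triangle_le add_mono)
  ultimately show ?thesis using nonneg by (auto simp: seminorm_on_def)
qed

lemma complete_bounded_maps:
  assumes V: "csubspace V" and p: "seminorm_on V p"
  shows "complete_space_on (bounded_maps V p UNIV cmod) (map_norm V p cmod)"
  unfolding complete_space_on_def
proof (intro allI impI)
  let ?B = "bounded_maps V p UNIV cmod" and ?N = "map_norm V p cmod"
  fix s :: "nat \<Rightarrow> 'a \<Rightarrow> complex"
  assume s: "\<forall>n. s n \<in> ?B" and Cau: "\<forall>e>0. \<exists>M. \<forall>m\<ge>M. \<forall>n\<ge>M. ?N (s m - s n) < e"
  have diff: "cmod (s m x - s n x) \<le> ?N (s m - s n) * p x" if "x \<in> V" for x m n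
    using functional_le[OF V p _ that, of "s m - s n"] s csubspace_bounded_maps[OF V p]
    by (simp add: complex_vector.subspace_diff)
  have diff2: "\<exists>M. \<forall>m\<ge>M. \<forall>n\<ge>M. \<forall>x\<in>V. cmod (s m x - s n x) \<le> e * p x" if e: "e > 0" for e
  proof -
    obtain M where M: "\<forall>m\<ge>M. \<forall>n\<ge>M. ?N (s m - s n) < e" using Cau e by meson
    have "cmod (s m x - s n x) \<le> e * p x" if "m \<ge> M" "n \<ge> M" "x \<in> V" for m n x
    proof -
      have "?N (s m - s n) * p x \<le> e * p x"
        using M that seminorm_onD(1)[OF p that(3)] by (intro mult_right_mono) (auto intro: less_imp_le)
      with diff[OF that(3)] show ?thesis by (rule order_trans)
    qed
    then show ?thesis by blast
  qed
  have "Cauchy (\<lambda>n. s n x)" if x: "x \<in> V" for x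
  proof (rule metric_CauchyI)
    fix e :: real assume "e > 0"
    have px: "0 \<le> p x" using seminorm_onD(1)[OF p x] .
    then have "e / (p x + 1) > 0" using \<open>e > 0\<close> by simp
    then obtain M where M: "\<forall>m\<ge>M. \<forall>n\<ge>M. cmod (s m x - s n x) \<le> e / (p x + 1) * p x"
      using diff2 x by blast
    have "e / (p x + 1) * p x < e" using \<open>e > 0\<close> px by (simp add: field_simps)
    with M show "\<exists>M. \<forall>m\<ge>M. \<forall>n\<ge>M. dist (s m x) (s n x) < e"
      by (metis dist_norm order_le_less_trans)
  qed
  moreover have "s n x = 0" if "x \<notin> V" for n x
    using s that by (simp add: bounded_maps_def)
  ultimately have "convergent (\<lambda>n. s n x)" for x
    by (cases "x \<in> V") (auto simp: Cauchy_convergent_iff convergent_const)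
  then obtain T where T: "(\<lambda>n. s n x) \<longlonglongrightarrow> T x" for x
    unfolding convergent_def by metis
  have close: "\<exists>M. \<forall>n\<ge>M. \<forall>x\<in>V. cmod (s n x - T x) \<le> e * p x" if e: "e > 0" for e
  proof -
    obtain M where M: "\<forall>m\<ge>M. \<forall>n\<ge>M. \<forall>x\<in>V. cmod (s m x - s n x) \<le> e * p x"
      using diff2[OF e] by blast
    have "cmod (s n x - T x) \<le> e * p x" if "n \<ge> M" "x \<in> V" for n x
    proof (rule LIMSEQ_le_const2)
      show "(\<lambda>m. cmod (s n x - s m x)) \<longlonglongrightarrow> cmod (s n x - T x)" by (intro tendsto_intros T)
    qed (use M that in blast)
    then show ?thesis by blast
  qed
  have TB: "T \<in> ?B"
  proof -
    have "T (x + y) = T x + T y" if "x \<in> V" "y \<in> V" for x y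
    proof (rule LIMSEQ_unique[OF T])
      show "(\<lambda>n. s n (x + y)) \<longlonglongrightarrow> T x + T y"
        using tendsto_add[OF T T, of x y] s that by (simp add: bounded_maps_def clinear_on_def)
    qed
    moreover have "T (a *\<^sub>C x) = a *\<^sub>C T x" if "x \<in> V" for a x
    proof (rule LIMSEQ_unique[OF T])
      show "(\<lambda>n. s n (a *\<^sub>C x)) \<longlonglongrightarrow> a *\<^sub>C T x"
        using tendsto_mult_left[OF T, of a x] s that
        by (simp add: bounded_maps_def clinear_on_def scaleC_complex_def)
    qed
    moreover have "T x = 0" if "x \<notin> V" for x
      using T[of x] s that by (simp add: bounded_maps_def LIMSEQ_const_iff)
    moreover have "\<exists>C. \<forall>x\<in>V. cmod (T x) \<le> C * p x"
    proof -
      obtain M where M: "\<forall>x\<in>V. cmod (s M x - T x) \<le> 1 * p x" using close[of 1] by auto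
      obtain C where C: "\<forall>x\<in>V. cmod (s M x) \<le> C * p x"
        using s unfolding bounded_maps_def by blast
      have "cmod (T x) \<le> (C + 1) * p x" if "x \<in> V" for x
        using M[rule_format, OF that] C[rule_format, OF that] norm_triangle_ineq4[of "s M x" "s M x - T x"]
        by (simp add: distrib_right)
      then show ?thesis by blast
    qed
    ultimately show ?thesis by (simp add: bounded_maps_def clinear_on_def)
  qed
  have "(\<lambda>n. ?N (s n - T)) \<longlonglongrightarrow> 0"
  proof (rule LIMSEQ_I)
    fix e :: real assume e: "e > 0"
    obtain M where M: "\<forall>n\<ge>M. \<forall>x\<in>V. cmod (s n x - T x) \<le> e/2 * p x" using close[of "e/2"] e by auto
    have "norm (?N (s n - T) - 0) < e" if "n \<ge> M" for n
    proof -
      have "?N (s n - T) \<le> e/2" using M that e by (intro map_norm_le[OF V p]) auto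
      moreover have "0 \<le> ?N (s n - T)"
        using seminorm_onD(1)[OF seminorm_on_bounded_maps[OF V p]] csubspace_bounded_maps[OF V p] TB s
        by (simp add: complex_vector.subspace_diff)
      ultimately show ?thesis using e by simp
    qed
    then show "\<exists>M. \<forall>n\<ge>M. norm (?N (s n - T) - 0) < e" by blast
  qed
  with TB show "\<exists>T\<in>?B. (\<lambda>n. ?N (s n - T)) \<longlonglongrightarrow> 0" by blast
qed

lemma norm_on_vnorm:
  assumes "operator_space X"
  shows "norm_on (vecs X) (vnorm X)"
proof -
  let ?e = "\<lambda>x::'a. \<lambda>(i::nat) (j::nat). if i = 0 \<and> j = 0 then x else 0"
  have 1: "norm_on (matrices 1 1 (vecs X)) (mnorm X 1)"
    using assms by (auto simp: operator_space_def)
  have e: "?e x \<in> matrices 1 1 (vecs X)" if "x \<in> vecs X" for x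
    using that by (auto simp: matrices_def)
  have "?e (x + y) = ?e x + ?e y" "?e (a *\<^sub>C x) = a *\<^sub>C ?e x" "?e x = 0 \<longleftrightarrow> x = 0" for x y a
    by (auto simp: fun_eq_iff scaleC_fun_def)
  then show ?thesis
    using 1 e by (simp add: norm_on_def vnorm_def)
qed

lemma csubspace_vecs: "operator_space X \<Longrightarrow> csubspace (vecs X)"
  by (simp add: operator_space_def)

section \<open>Boundedness of vector measures\<close>

locale vector_measure =
  fixes V :: "'x::complex_vector set" and p :: "'x \<Rightarrow> real"
    and m :: "'a measure" and \<nu> :: "'a set \<Rightarrow> 'x"
  assumes subspace: "csubspace V" and norm: "norm_on V p"
    and in_subspace: "\<And>A. A \<in> sets m \<Longrightarrow> \<nu> A \<in> V"
    and add: "\<And>A :: nat \<Rightarrow> _. range A \<subseteq> sets m \<Longrightarrow> disjoint_family A \<Longrightarrow>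
       (\<lambda>n. p ((\<Sum>k<n. \<nu> (A k)) - \<nu> (\<Union>k. A k))) \<longlonglongrightarrow> 0"
begin

lemma seminorm: "seminorm_on V p"
  using norm by (rule norm_on_imp_seminorm_on)

text \<open>Two disjoint sets are padded with empty sets to a sequence, which requires \<open>\<nu> {} = 0\<close>. That holds
because consecutive partial sums of the constant family \<open>{}\<close> differ by \<open>\<nu> {}\<close> and have the same
limit.\<close>

lemma finite_additive:
  shows "\<nu> {} = 0"
    and "A \<in> sets m \<Longrightarrow> B \<in> sets m \<Longrightarrow> A \<inter> B = {} \<Longrightarrow> \<nu> (A \<union> B) = \<nu> A + \<nu> B"
proof -
  have def0: "x = 0" if "x \<in> V" "p x \<le> 0" for x
    using norm that unfolding norm_on_def by force
  have E: "\<nu> {} \<in> V" using in_subspace by simp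
  show empty: "\<nu> {} = 0"
  proof (rule def0[OF E])
    define f where "f n = p ((\<Sum>k<n. \<nu> {}) - \<nu> {})" for n :: nat
    have f: "f \<longlonglongrightarrow> 0" using add[of "\<lambda>_. {}"] by (simp add: f_def[abs_def] disjoint_family_on_def)
    have SV: "(\<Sum>k<n. \<nu> {}) - \<nu> {} \<in> V" for n :: nat
      using subspace E by (intro complex_vector.subspace_diff complex_vector.subspace_sum) auto
    show "p (\<nu> {}) \<le> 0"
    proof (rule LIMSEQ_le_const)
      show "(\<lambda>n. f (Suc n) + f n) \<longlonglongrightarrow> 0"
        using tendsto_add[OF LIMSEQ_Suc[OF f] f] by simp
      have "p (\<nu> {}) \<le> f (Suc n) + f n" for n
        using seminorm_on_diff[OF seminorm subspace SV[of "Suc n"] SV[of n]] by (simp add: f_def)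
      then show "\<exists>N. \<forall>n\<ge>N. p (\<nu> {}) \<le> f (Suc n) + f n" by blast
    qed
  qed
  show "\<nu> (A \<union> B) = \<nu> A + \<nu> B" if AB: "A \<in> sets m" "B \<in> sets m" "A \<inter> B = {}"
  proof -
    define C where "C = (\<lambda>k::nat. if k = 0 then A else if k = 1 then B else {})"
    have UC: "(\<Union>k. C k) = A \<union> B"
    proof (rule equalityI)
      have "A = C 0" "B = C 1" by (auto simp: C_def)
      then show "A \<union> B \<subseteq> (\<Union>k. C k)" by blast
    qed (auto simp: C_def split: if_splits)
    have "(\<Sum>k<Suc (Suc n). \<nu> (C k)) = \<nu> A + \<nu> B" for n
      by (induction n) (simp_all add: C_def empty)
    then have eq: "(\<Sum>k<n. \<nu> (C k)) = \<nu> A + \<nu> B" if "n \<ge> 2" for n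
      using that by (metis Suc_le_D Suc_le_mono numeral_2_eq_2)
    have "(\<lambda>n. p ((\<Sum>k<n. \<nu> (C k)) - \<nu> (\<Union>k. C k))) \<longlonglongrightarrow> 0"
      using AB by (intro add) (auto simp: C_def disjoint_family_on_def)
    moreover have "(\<lambda>n. p ((\<Sum>k<n. \<nu> (C k)) - \<nu> (\<Union>k. C k))) \<longlonglongrightarrow> p (\<nu> A + \<nu> B - \<nu> (A \<union> B))"
      by (rule tendsto_eventually) (auto simp: UC eq eventually_sequentially intro!: exI[of _ 2])
    ultimately have "p (\<nu> A + \<nu> B - \<nu> (A \<union> B)) = 0" using LIMSEQ_unique by blast
    moreover have "\<nu> A + \<nu> B - \<nu> (A \<union> B) \<in> V"
      using subspace AB in_subspace by (intro complex_vector.subspace_diff complex_vector.subspace_add) auto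
    ultimately show ?thesis using def0 by fastforce
  qed
qed

text \<open>Call \<open>A\<close> unbounded if \<open>\<nu>\<close> is unbounded on its subsets. If \<open>C \<subseteq> A\<close> has a value much larger than that
of \<open>A\<close>, then so has \<open>A - C\<close>, and one of the two is again unbounded. Iterating gives a decreasing
sequence whose values tend to infinity in norm, while countable additivity makes these values
converge.\<close>

lemma bounded_range:
  shows "\<exists>K. \<forall>A\<in>sets m. p (\<nu> A) \<le> K"
proof (rule ccontr)
  have split: "\<nu> A = \<nu> (A \<inter> C) + \<nu> (A - C)" if "A \<in> sets m" "C \<in> sets m" for A C
    using finite_additive(2)[where A="A \<inter> C" and B="A - C"] that by (simp add: Int_Diff_disjoint Un_Diff_Int Int_Diff_Un)
  define unbd where "unbd A \<longleftrightarrow> (\<forall>K. \<exists>B\<in>sets m. B \<subseteq> A \<and> p (\<nu> B) > K)" for A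
  assume "\<not> (\<exists>K. \<forall>A\<in>sets m. p (\<nu> A) \<le> K)"
  then have unbd_space: "unbd (space m)"
    unfolding unbd_def by (metis not_le sets.sets_into_space)
  have step: "\<exists>B\<in>sets m. B \<subseteq> A \<and> unbd B \<and> p (\<nu> B) \<ge> K" if A: "A \<in> sets m" and "unbd A" for A K
  proof -
    obtain C where C: "C \<in> sets m" "C \<subseteq> A" "p (\<nu> C) > \<bar>K\<bar> + p (\<nu> A)"
      using \<open>unbd A\<close> unfolding unbd_def by blast
    have "\<nu> C = \<nu> A - \<nu> (A - C)"
      using split[OF A C(1)] C(2) by (simp add: Int_absorb1)
    then have "p (\<nu> C) \<le> p (\<nu> A) + p (\<nu> (A - C))"
      using seminorm_on_diff[OF seminorm subspace] in_subspace A C by auto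
    then have large: "K \<le> p (\<nu> C)" "K \<le> p (\<nu> (A - C))"
      using C(3) seminorm_onD(1)[OF seminorm in_subspace[OF A]] by linarith+
    have "unbd C \<or> unbd (A - C)"
    proof (rule ccontr)
      assume "\<not> ?thesis"
      then obtain K1 K2 where K1: "\<And>B. B \<in> sets m \<Longrightarrow> B \<subseteq> C \<Longrightarrow> p (\<nu> B) \<le> K1"
        and K2: "\<And>B. B \<in> sets m \<Longrightarrow> B \<subseteq> A - C \<Longrightarrow> p (\<nu> B) \<le> K2"
        unfolding unbd_def by (meson not_le)
      have "p (\<nu> B) \<le> K1 + K2" if "B \<in> sets m" "B \<subseteq> A" for B
        using seminorm_onD(2)[OF seminorm in_subspace in_subspace, of "B \<inter> C" "B - C"] split[of B C]
          K1[of "B \<inter> C"] K2[of "B - C"] that C(1) by force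
      with \<open>unbd A\<close> show False unfolding unbd_def by (meson not_le)
    qed
    with large C A show ?thesis by blast
  qed
  have "\<exists>B. \<forall>n. (B n \<in> sets m \<and> unbd (B n) \<and> real n \<le> p (\<nu> (B n))) \<and> B (Suc n) \<subseteq> B n"
  proof (rule dependent_nat_choice)
    show "\<exists>x. x \<in> sets m \<and> unbd x \<and> real 0 \<le> p (\<nu> x)"
      using unbd_space seminorm_onD(1)[OF seminorm in_subspace] by force
  qed (use step in blast)
  then obtain B where B: "\<And>n. B n \<in> sets m" and large: "\<And>n. real n \<le> p (\<nu> (B n))"
    and dec: "\<And>n. B (Suc n) \<subseteq> B n" by blast
  define A where "A n = B n - B (Suc n)" for n
  have anti: "B l \<subseteq> B k" if "k \<le> l" for k l using dec that by (rule lift_Suc_antimono_le)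
  have A: "A n \<in> sets m" for n using B by (simp add: A_def)
  have disj: "disjoint_family A"
    unfolding disjoint_family_on_def
  proof (intro ballI impI)
    fix k l :: nat assume "k \<noteq> l"
    then show "A k \<inter> A l = {}"
      using anti[of "Suc k" l] anti[of "Suc l" k] by (cases "k < l") (auto simp: A_def)
  qed
  have tele: "(\<Sum>k<n. \<nu> (A k)) = \<nu> (B 0) - \<nu> (B n)" for n
  proof (induction n)
    case (Suc n)
    have "\<nu> (B n) = \<nu> (B (Suc n)) + \<nu> (A n)"
      using split[OF B B, of n "Suc n"] dec[of n] by (simp add: A_def Int_absorb1)
    with Suc show ?case by simp
  qed simp
  define U where "U = (\<Union>k. A k)"
  have U: "U \<in> sets m" using A unfolding U_def by blast
  have "(\<lambda>n. p ((\<Sum>k<n. \<nu> (A k)) - \<nu> U)) \<longlonglongrightarrow> 0"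
    unfolding U_def using A disj by (intro add) auto
  then obtain K where K: "\<And>n. p ((\<Sum>k<n. \<nu> (A k)) - \<nu> U) \<le> K"
    using convergent_imp_Bseq[unfolded convergent_def] by (metis BseqE real_norm_def abs_le_D1)
  have "p (\<nu> (B n)) \<le> p (\<nu> (B 0)) + p (\<nu> U) + K" for n
  proof -
    have "\<nu> (B n) = (\<nu> (B 0) - \<nu> U) - ((\<Sum>k<n. \<nu> (A k)) - \<nu> U)" by (simp add: tele)
    also have "p \<dots> \<le> p (\<nu> (B 0) - \<nu> U) + p ((\<Sum>k<n. \<nu> (A k)) - \<nu> U)"
      using in_subspace A B U subspace by (intro seminorm_on_diff[OF seminorm subspace] complex_vector.subspace_diff
          complex_vector.subspace_sum) auto
    finally show ?thesis
      using K[of n] seminorm_on_diff[OF seminorm subspace in_subspace[OF B] in_subspace[OF U], of 0] by linarith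
  qed
  moreover obtain n where "p (\<nu> (B 0)) + p (\<nu> U) + K < real n" using reals_Archimedean2 by blast
  ultimately show False using large[of n] by (meson not_le order_trans)
qed

end

section \<open>Densities of complex measures\<close>

text \<open>The positive part \<open>\<mu>\<^sup>+\<close> in the Jordan decomposition.\<close>

definition upper_variation :: "'a measure \<Rightarrow> ('a set \<Rightarrow> real) \<Rightarrow> 'a set \<Rightarrow> real"
  where "upper_variation m \<mu> A = (SUP B\<in>{B \<in> sets m. B \<subseteq> A}. \<mu> B)"

locale bounded_real_measure =
  fixes m :: "'a measure" and \<mu> :: "'a set \<Rightarrow> real" and K :: real
  assumes add: "\<And>A :: nat \<Rightarrow> _. range A \<subseteq> sets m \<Longrightarrow> disjoint_family A \<Longrightarrow>
      (\<lambda>k. \<mu> (A k)) sums \<mu> (\<Union>k. A k)"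
    and bounded: "\<And>A. A \<in> sets m \<Longrightarrow> \<bar>\<mu> A\<bar> \<le> K"
begin

lemma measure_empty: "\<mu> {} = 0"
proof -
  have "(\<lambda>k::nat. \<mu> {}) sums \<mu> {}" using add[of "\<lambda>_. {}"] by (simp add: disjoint_family_on_def)
  then have "(\<lambda>k::nat. \<mu> {}) \<longlonglongrightarrow> 0" by (intro summable_LIMSEQ_zero) (rule sums_summable)
  then show ?thesis by (simp add: LIMSEQ_const_iff)
qed

lemma measure_Un:
  assumes "A \<in> sets m" "B \<in> sets m" "A \<inter> B = {}"
  shows "\<mu> (A \<union> B) = \<mu> A + \<mu> B"
proof -
  define C where "C = (\<lambda>k::nat. if k = 0 then A else if k = 1 then B else {})"
  have "A = C 0" "B = C 1" by (auto simp: C_def)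
  moreover have "C k \<subseteq> A \<union> B" for k by (simp add: C_def)
  ultimately have "(\<Union>k. C k) = A \<union> B" by blast
  moreover have "range C \<subseteq> sets m" "disjoint_family C"
    using assms by (auto simp: C_def disjoint_family_on_def)
  ultimately have "(\<lambda>k. \<mu> (C k)) sums \<mu> (A \<union> B)" using add[of C] by simp
  moreover have "(\<lambda>k. \<mu> (C k)) sums (\<Sum>k\<in>{0,1}. \<mu> (C k))"
    by (rule sums_finite) (auto simp: C_def measure_empty)
  ultimately show ?thesis using sums_unique2 by (fastforce simp: C_def)
qed

lemma le_upper_variation:
  assumes "B \<in> sets m" "B \<subseteq> A"
  shows "\<mu> B \<le> upper_variation m \<mu> A"
  unfolding upper_variation_def
  by (rule cSUP_upper) (use assms bounded in \<open>auto intro!: bdd_aboveI2[of _ _ K] simp: abs_le_iff\<close>)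

lemma upper_variation_le:
  assumes "\<And>B. B \<in> sets m \<Longrightarrow> B \<subseteq> A \<Longrightarrow> \<mu> B \<le> c"
  shows "upper_variation m \<mu> A \<le> c"
  unfolding upper_variation_def by (rule cSUP_least) (use assms in auto)

lemma upper_variation_nonneg: "0 \<le> upper_variation m \<mu> A"
  using le_upper_variation[of "{}" A] measure_empty by simp

lemma upper_variation_Un:
  assumes A: "A \<in> sets m" "B \<in> sets m" "A \<inter> B = {}"
  shows "upper_variation m \<mu> A + upper_variation m \<mu> B \<le> upper_variation m \<mu> (A \<union> B)"
proof -
  have "\<mu> C + \<mu> D \<le> upper_variation m \<mu> (A \<union> B)"
    if "C \<in> sets m" "C \<subseteq> A" "D \<in> sets m" "D \<subseteq> B" for C D
  proof -
    have "C \<inter> D = {}" using that A by blast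
    then have "\<mu> C + \<mu> D = \<mu> (C \<union> D)" using measure_Un that by simp
    also have "\<dots> \<le> upper_variation m \<mu> (A \<union> B)"
      using that by (intro le_upper_variation) auto
    finally show ?thesis .
  qed
  then have "upper_variation m \<mu> A \<le> upper_variation m \<mu> (A \<union> B) - \<mu> D"
    if "D \<in> sets m" "D \<subseteq> B" for D
    using that by (intro upper_variation_le) (simp add: algebra_simps)
  then have "upper_variation m \<mu> B \<le> upper_variation m \<mu> (A \<union> B) - upper_variation m \<mu> A"
    by (intro upper_variation_le) (simp add: algebra_simps)
  then show ?thesis by simp
qed

text \<open>One inequality follows from finite superadditivity. For the other, each \<open>B\<close> inside the union is cut
into the pieces \<open>B \<inter> A k\<close>, to which the additivity of \<open>\<mu>\<close> applies.\<close>

lemma upper_variation_countably_additive: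
  "countably_additive (sets m) (\<lambda>A. ennreal (upper_variation m \<mu> A))"
proof (rule countably_additiveI)
  fix A :: "nat \<Rightarrow> 'a set"
  assume A: "range A \<subseteq> sets m" and disj: "disjoint_family A" and U: "(\<Union>k. A k) \<in> sets m"
  let ?P = "upper_variation m \<mu>"
  show "(\<Sum>k. ennreal (?P (A k))) = ennreal (?P (\<Union>k. A k))"
  proof (rule antisym)
    have "(\<Sum>k<n. ?P (A k)) \<le> ?P (\<Union>k<n. A k)" for n
    proof (induction n)
      case 0 then show ?case by (simp add: upper_variation_nonneg)
    next
      case (Suc n)
      have "(\<Union>k<n. A k) \<inter> A n = {}"
        using disj by (auto simp: disjoint_family_on_def) (metis disjoint_iff less_irrefl)
      then have "?P (\<Union>k<n. A k) + ?P (A n) \<le> ?P ((\<Union>k<n. A k) \<union> A n)"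
        using A by (intro upper_variation_Un) auto
      with Suc show ?case by (simp add: lessThan_Suc Un_commute)
    qed
    also have "?P (\<Union>k<n. A k) \<le> ?P (\<Union>k. A k)" for n
      by (rule upper_variation_le) (blast intro: le_upper_variation)
    finally have "(\<Sum>k<n. ennreal (?P (A k))) \<le> ennreal (?P (\<Union>k. A k))" for n
      by (simp add: sum_ennreal upper_variation_nonneg ennreal_leI)
    then show "(\<Sum>k. ennreal (?P (A k))) \<le> ennreal (?P (\<Union>k. A k))"
      by (rule suminf_le_const[OF summableI])
  next
    have le: "ennreal (\<mu> B) \<le> (\<Sum>k. ennreal (?P (A k)))" if B: "B \<in> sets m" "B \<subseteq> (\<Union>k. A k)" for B
    proof -
      have "(\<lambda>k. \<mu> (B \<inter> A k)) sums \<mu> (\<Union>k. B \<inter> A k)"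
      proof (rule add)
        show "disjoint_family (\<lambda>k. B \<inter> A k)" using disj unfolding disjoint_family_on_def by blast
      qed (use A B in auto)
      moreover have "(\<Union>k. B \<inter> A k) = B" using B by blast
      ultimately have "(\<lambda>n. ennreal (\<Sum>k<n. \<mu> (B \<inter> A k))) \<longlonglongrightarrow> ennreal (\<mu> B)"
        by (intro tendsto_ennrealI) (simp add: sums_def)
      moreover have "ennreal (\<Sum>k<n. \<mu> (B \<inter> A k)) \<le> (\<Sum>k. ennreal (?P (A k)))" for n
      proof -
        have "(\<Sum>k<n. \<mu> (B \<inter> A k)) \<le> (\<Sum>k<n. ?P (A k))"
          using A B by (intro sum_mono le_upper_variation) auto
        then have "ennreal (\<Sum>k<n. \<mu> (B \<inter> A k)) \<le> (\<Sum>k<n. ennreal (?P (A k)))"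
          by (simp add: sum_ennreal upper_variation_nonneg ennreal_leI)
        also have "\<dots> \<le> (\<Sum>k. ennreal (?P (A k)))" by (intro sum_le_suminf) auto
        finally show ?thesis .
      qed
      ultimately show ?thesis by (intro LIMSEQ_le_const2) auto
    qed
    show "ennreal (?P (\<Union>k. A k)) \<le> (\<Sum>k. ennreal (?P (A k)))"
    proof (cases "\<Sum>k. ennreal (?P (A k))")
      case (real r)
      have "?P (\<Union>k. A k) \<le> r"
        by (rule upper_variation_le) (use le real in \<open>auto simp: ennreal_le_iff\<close>)
      then show ?thesis using real by (simp add: ennreal_leI)
    qed simp
  qed
qed

lemma upper_variation_density:
  assumes fin: "finite_measure m" and ac: "\<And>A. A \<in> null_sets m \<Longrightarrow> \<mu> A = 0"
  shows "\<exists>h. integrable m h \<and> (\<forall>A\<in>sets m. upper_variation m \<mu> A = (LINT t:A|m. h t))"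
proof -
  interpret finite_measure m by fact
  let ?P = "upper_variation m \<mu>"
  define N where "N = measure_of (space m) (sets m) (\<lambda>A. ennreal (?P A))"
  have P0: "?P {} = 0"
    using upper_variation_nonneg[of "{}"] upper_variation_le[of "{}" 0] measure_empty by auto
  have sets_N: "sets N = sets m" by (simp add: N_def)
  have N: "emeasure N A = ennreal (?P A)" if "A \<in> sets m" for A
    using that P0 upper_variation_countably_additive sets.space_closed[of m]
    by (intro emeasure_measure_of[OF N_def]) (auto simp: sets_N positive_def)
  have space_N: "space N = space m" using sets_N by (rule sets_eq_imp_space_eq)
  have "finite_measure N"
    by (rule finite_measureI) (simp add: space_N N)
  moreover have "absolutely_continuous m N"
    unfolding absolutely_continuous_def
  proof
    fix A assume A: "A \<in> null_sets m"
    have "\<mu> B \<le> 0" if "B \<in> sets m" "B \<subseteq> A" for B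
      using ac[of B] null_sets_subset[OF A] that by simp
    then have "?P A = 0" by (intro antisym upper_variation_le upper_variation_nonneg)
    then show "A \<in> null_sets N" using N[of A] A sets_N by (auto simp: null_sets_def)
  qed
  ultimately obtain D where D: "D \<in> borel_measurable m" "AE x in m. RN_deriv m N x = ennreal (D x)"
    "\<And>x. 0 \<le> D x" and den: "density m (RN_deriv m N) = N"
    using real_RN_deriv[of N] density_RN_deriv[of N] sets_N by metis
  have nn: "(\<integral>\<^sup>+t. ennreal (indicator A t * D t) \<partial>m) = ennreal (?P A)" if A: "A \<in> sets m" for A
  proof -
    have "ennreal (?P A) = emeasure (density m (RN_deriv m N)) A" using N[OF A] den by simp
    also have "\<dots> = (\<integral>\<^sup>+t. RN_deriv m N t * indicator A t \<partial>m)"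
      using A by (intro emeasure_density) auto
    also have "\<dots> = (\<integral>\<^sup>+t. ennreal (indicator A t * D t) \<partial>m)"
      using D(2) by (intro nn_integral_cong_AE) (auto elim!: eventually_mono split: split_indicator)
    finally show ?thesis by simp
  qed
  have "integrable m D"
    using nn[OF sets.top] D
    by (intro integrableI_nonneg) (auto cong: nn_integral_cong_simp simp: indicator_def)
  moreover have "?P A = (LINT t:A|m. D t)" if "A \<in> sets m" for A
    unfolding set_lebesgue_integral_def
    using D that nn[OF that]
    by (subst integral_eq_nn_integral) (auto simp: upper_variation_nonneg)
  ultimately show ?thesis by blast
qed

end

text \<open>\<open>\<mu>\<close> is the difference of its upper variation and that of \<open>- \<mu>\<close>, and the Radon--Nikodym theorem for
finite positive measures applies to both.\<close>

lemma real_measure_density: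
  fixes m :: "'a measure" and \<mu> :: "'a set \<Rightarrow> real"
  assumes fin: "finite_measure m"
    and add: "\<And>A :: nat \<Rightarrow> _. range A \<subseteq> sets m \<Longrightarrow> disjoint_family A \<Longrightarrow>
      (\<lambda>k. \<mu> (A k)) sums \<mu> (\<Union>k. A k)"
    and bounded: "\<And>A. A \<in> sets m \<Longrightarrow> \<bar>\<mu> A\<bar> \<le> K"
    and ac: "\<And>A. A \<in> null_sets m \<Longrightarrow> \<mu> A = 0"
  shows "\<exists>h. integrable m h \<and> (\<forall>A\<in>sets m. \<mu> A = (LINT t:A|m. h t))"
proof -
  let ?\<mu>' = "\<lambda>A. - \<mu> A"
  interpret pos: bounded_real_measure m \<mu> K using add bounded by unfold_locales
  interpret neg: bounded_real_measure m ?\<mu>' K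
    using add bounded by unfold_locales (auto intro: sums_minus)
  obtain f g where f: "integrable m f" "\<forall>A\<in>sets m. upper_variation m \<mu> A = (LINT t:A|m. f t)"
    and g: "integrable m g" "\<forall>A\<in>sets m. upper_variation m ?\<mu>' A = (LINT t:A|m. g t)"
    using pos.upper_variation_density[OF fin ac] neg.upper_variation_density[OF fin] ac
    by (metis neg_0_equal_iff_equal)
  have "\<mu> A = upper_variation m \<mu> A - upper_variation m ?\<mu>' A" if A: "A \<in> sets m" for A
  proof -
    have split: "\<mu> A = \<mu> B + \<mu> (A - B)" if "B \<in> sets m" "B \<subseteq> A" for B
      using pos.measure_Un[of B "A - B"] that A by (simp add: Un_absorb1)
    have "upper_variation m \<mu> A \<le> \<mu> A + upper_variation m ?\<mu>' A"
    proof (rule pos.upper_variation_le)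
      fix B assume "B \<in> sets m" "B \<subseteq> A"
      then show "\<mu> B \<le> \<mu> A + upper_variation m ?\<mu>' A"
        using split neg.le_upper_variation[of "A - B" A] A by force
    qed
    moreover have "upper_variation m ?\<mu>' A \<le> upper_variation m \<mu> A - \<mu> A"
    proof (rule neg.upper_variation_le)
      fix B assume "B \<in> sets m" "B \<subseteq> A"
      then show "- \<mu> B \<le> upper_variation m \<mu> A - \<mu> A"
        using split pos.le_upper_variation[of "A - B" A] A by force
    qed
    ultimately show ?thesis by simp
  qed
  moreover have "set_integrable m A f" "set_integrable m A g" if "A \<in> sets m" for A
    unfolding set_integrable_def using f g that by (intro integrable_mult_indicator; simp)+
  ultimately have "\<forall>A\<in>sets m. \<mu> A = (LINT t:A|m. f t - g t)"
    using f g by (simp add: set_integral_diff)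
  with f g show ?thesis by (intro exI[of _ "\<lambda>t. f t - g t"]) auto
qed

lemma complex_measure_density:
  fixes m :: "'a measure" and \<mu> :: "'a set \<Rightarrow> complex"
  assumes fin: "finite_measure m"
    and add: "\<And>A :: nat \<Rightarrow> _. range A \<subseteq> sets m \<Longrightarrow> disjoint_family A \<Longrightarrow>
      (\<lambda>k. \<mu> (A k)) sums \<mu> (\<Union>k. A k)"
    and bounded: "\<And>A. A \<in> sets m \<Longrightarrow> cmod (\<mu> A) \<le> K"
    and ac: "\<And>A. A \<in> null_sets m \<Longrightarrow> \<mu> A = 0"
  shows "\<exists>h. integrable m h \<and> (\<forall>A\<in>sets m. \<mu> A = (LINT t:A|m. h t))"
proof -
  have "\<exists>h. integrable m h \<and> (\<forall>A\<in>sets m. Re (\<mu> A) = (LINT t:A|m. h t))"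
    using add bounded ac abs_Re_le_cmod order_trans
    by (intro real_measure_density[OF fin, of _ K]) (auto simp: sums_complex_iff, blast)
  moreover have "\<exists>h. integrable m h \<and> (\<forall>A\<in>sets m. Im (\<mu> A) = (LINT t:A|m. h t))"
    using add bounded ac abs_Im_le_cmod order_trans
    by (intro real_measure_density[OF fin, of _ K]) (auto simp: sums_complex_iff, blast)
  ultimately obtain f g where f: "integrable m f" "\<And>A. A \<in> sets m \<Longrightarrow> Re (\<mu> A) = (LINT t:A|m. f t)"
    and g: "integrable m g" "\<And>A. A \<in> sets m \<Longrightarrow> Im (\<mu> A) = (LINT t:A|m. g t)"
    by blast
  have "\<mu> A = (LINT t:A|m. complex_of_real (f t) + \<i> * complex_of_real (g t))" if A: "A \<in> sets m" for A
  proof -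
    have "set_integrable m A (\<lambda>t. complex_of_real (f t))" "set_integrable m A (\<lambda>t. complex_of_real (g t))"
      unfolding set_integrable_def using f(1) g(1) A by (intro integrable_mult_indicator; simp)+
    then show ?thesis
      using f(2)[OF A] g(2)[OF A] complex_eq[of "\<mu> A"]
      by (simp add: set_integral_add set_integral_complex_of_real)
  qed
  with f g show ?thesis
    by (intro exI[of _ "\<lambda>t. complex_of_real (f t) + \<i> * complex_of_real (g t)"]) auto
qed

section \<open>Total variation\<close>

text \<open>Every partition sum is at most \<open>\<integral> |h|\<close> by the triangle inequality. Conversely, a simple function \<open>s\<close>
with \<open>|s| \<le> 1\<close> is constant on the members of a finite partition, so \<open>|\<integral> s h|\<close> is at most a partition
sum; letting \<open>s\<close> tend to the conjugate of the phase of \<open>h\<close> gives \<open>\<integral> |h|\<close>. The equality also shows that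
the suprema of partition sums are countably additive.\<close>

lemma total_variation_eq_density:
  fixes m :: "'g::topological_space measure"
  assumes sets_m: "sets m = sets borel" and h: "integrable m h"
    and \<mu>: "\<And>A. A \<in> sets m \<Longrightarrow> \<mu> A = (LINT t:A|m. h t)"
  shows "total_variation \<mu> = density m (\<lambda>t. ennreal (cmod (h t)))"
proof -
  let ?D = "density m (\<lambda>t. ennreal (cmod (h t)))"
  have [measurable]: "h \<in> borel_measurable m" using h by simp
  have hA: "integrable m (\<lambda>t. indicator A t *\<^sub>R h t)" if "A \<in> sets m" for A
    using that h by (rule integrable_mult_indicator)
  have D: "emeasure ?D A = (\<integral>\<^sup>+t. ennreal (cmod (indicator A t *\<^sub>R h t)) \<partial>m)" if "A \<in> sets m" for A
    using that by (simp add: emeasure_density) (auto intro!: nn_integral_cong split: split_indicator)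
  have D': "emeasure ?D A = ennreal (LINT t:A|m. cmod (h t))" if "A \<in> sets m" for A
    unfolding D[OF that] set_lebesgue_integral_def
    using nn_integral_eq_integral[OF integrable_norm[OF hA[OF that]]] by simp
  define V where "V A = (SUP P\<in>{P. finite P \<and> partition_on A P \<and> P \<subseteq> sets borel}.
    \<Sum>B\<in>P. ennreal (cmod (\<mu> B)))" for A
  have upper: "V A \<le> emeasure ?D A" if A: "A \<in> sets m" for A
    unfolding V_def
  proof (rule SUP_least, safe)
    fix P assume P: "finite P" "partition_on A P" "P \<subseteq> sets borel"
    have "ennreal (cmod (\<mu> B)) \<le> emeasure ?D B" if "B \<in> P" for B
    proof -
      have B: "B \<in> sets m" using that P sets_m by auto
      show ?thesis
        unfolding D[OF B] \<mu>[OF B] set_lebesgue_integral_def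
        by (rule integral_norm_bound_ennreal[OF hA[OF B]])
    qed
    then have "(\<Sum>B\<in>P. ennreal (cmod (\<mu> B))) \<le> (\<Sum>B\<in>P. emeasure ?D B)" by (rule sum_mono)
    also have "\<dots> = emeasure ?D (\<Union>B\<in>P. B)"
      using P sets_m by (intro sum_emeasure)
        (auto simp: partition_on_def disjoint_def disjoint_family_on_def)
    also have "(\<Union>B\<in>P. B) = A" using P by (simp add: partition_on_def)
    finally show "(\<Sum>B\<in>P. ennreal (cmod (\<mu> B))) \<le> emeasure ?D A" .
  qed
  have simple: "ennreal (cmod (LINT t:A|m. s t * h t)) \<le> V A"
    if A: "A \<in> sets m" and s: "simple_function m s" and le1: "\<And>t. t \<in> space m \<Longrightarrow> cmod (s t) \<le> 1" for A s
  proof -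
    let ?B = "\<lambda>c. A \<inter> (s -` {c} \<inter> space m)"
    let ?R = "s ` space m"
    have fin: "finite ?R" using s by (rule simple_functionD)
    have B: "?B c \<in> sets m" for c using A simple_functionD(2)[OF s] by blast
    have "indicator A t *\<^sub>R (s t * h t) = (\<Sum>c\<in>?R. c * (indicator (?B c) t *\<^sub>R h t))"
      if t: "t \<in> space m" for t
    proof -
      have "(\<Sum>c\<in>?R. c * (indicator (?B c) t *\<^sub>R h t))
          = (\<Sum>c\<in>?R. if c = s t then indicator A t *\<^sub>R (s t * h t) else 0)"
        using t by (intro sum.cong) (auto split: split_indicator)
      also have "\<dots> = indicator A t *\<^sub>R (s t * h t)" using fin t by (subst sum.delta) auto
      finally show ?thesis by simp
    qed
    then have "(LINT t:A|m. s t * h t) = (\<integral>t. (\<Sum>c\<in>?R. c * (indicator (?B c) t *\<^sub>R h t)) \<partial>m)"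
      unfolding set_lebesgue_integral_def by (intro Bochner_Integration.integral_cong) auto
    also have "\<dots> = (\<Sum>c\<in>?R. \<integral>t. c * (indicator (?B c) t *\<^sub>R h t) \<partial>m)"
      using hA[OF B] by (intro Bochner_Integration.integral_sum) (intro integrable_mult_right)
    also have "\<dots> = (\<Sum>c\<in>?R. c * \<mu> (?B c))"
      using \<mu>[OF B] by (simp only: integral_mult_right_zero set_lebesgue_integral_def)
    finally have "cmod (LINT t:A|m. s t * h t) \<le> (\<Sum>c\<in>?R. cmod (c * \<mu> (?B c)))"
      by (simp only: norm_sum)
    also have "\<dots> \<le> (\<Sum>c\<in>?R. cmod (\<mu> (?B c)))"
      using le1 by (intro sum_mono) (auto simp: norm_mult intro!: mult_left_le_one_le)
    also have "\<dots> = (\<Sum>c\<in>{c \<in> ?R. ?B c \<noteq> {}}. cmod (\<mu> (?B c)))"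
      using fin \<mu>[of "{}"] by (intro sum.mono_neutral_right) (auto simp: set_lebesgue_integral_def)
    also have "\<dots> = (\<Sum>B\<in>?B ` {c \<in> ?R. ?B c \<noteq> {}}. cmod (\<mu> B))"
      by (rule sum.reindex[symmetric, unfolded o_def]) (auto simp: inj_on_def)
    finally have "ennreal (cmod (LINT t:A|m. s t * h t))
        \<le> (\<Sum>B\<in>?B ` {c \<in> ?R. ?B c \<noteq> {}}. ennreal (cmod (\<mu> B)))"
      by (simp add: sum_ennreal ennreal_leI)
    also have "\<dots> \<le> V A"
    proof -
      have "partition_on A (?B ` {c \<in> ?R. ?B c \<noteq> {}})"
      proof (rule partition_onI)
        show "\<Union> (?B ` {c \<in> ?R. ?B c \<noteq> {}}) = A"
          using sets.sets_into_space[OF A] by auto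
      qed (auto simp: disjnt_def)
      then show ?thesis
        unfolding V_def using fin B sets_m by (intro SUP_upper) auto
    qed
    finally show ?thesis .
  qed
  have lower: "emeasure ?D A \<le> V A" if A: "A \<in> sets m" for A
  proof -
    let ?u = "\<lambda>t. cnj (sgn (h t))"
    have [measurable]: "cnj \<in> borel_measurable borel"
      by (intro borel_measurable_continuous_onI continuous_intros)
    have "?u \<in> borel_measurable m" unfolding sgn_div_norm by measurable
    from borel_measurable_implies_sequence_metric[OF this, of 0] obtain F
      where F: "\<And>i. simple_function m (F i)"
        and lim: "\<And>t. t \<in> space m \<Longrightarrow> (\<lambda>i. F i t) \<longlonglongrightarrow> ?u t"
      by auto
    (* the approximants of the unimodular function may leave the unit disc; scale them back *)
    define s where "s i t = F i t / complex_of_real (max 1 (cmod (F i t)))" for i t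
    have s: "simple_function m (s i)" for i
      unfolding s_def by (rule simple_function_compose1[OF F])
    have le1: "cmod (s i t) \<le> 1" for i t by (simp add: s_def norm_divide divide_simps)
    have [measurable]: "s i \<in> borel_measurable m" for i
      using s by (rule borel_measurable_simple_function)
    have slim: "(\<lambda>i. s i t) \<longlonglongrightarrow> ?u t" if "t \<in> space m" for t
    proof -
      have "(\<lambda>i. s i t) \<longlonglongrightarrow> ?u t / complex_of_real (max 1 (cmod (?u t)))"
        unfolding s_def using lim[OF that] by (intro tendsto_intros) auto
      moreover have "max 1 (cmod (?u t)) = 1" by (simp add: norm_sgn)
      ultimately show ?thesis by simp
    qed
    have "(\<lambda>i. LINT t:A|m. s i t * h t) \<longlonglongrightarrow> (LINT t:A|m. ?u t * h t)"
      unfolding set_lebesgue_integral_def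
    proof (rule integral_dominated_convergence[where w="\<lambda>t. cmod (h t)"])
      show "AE t in m. (\<lambda>i. indicator A t *\<^sub>R (s i t * h t)) \<longlonglongrightarrow> indicator A t *\<^sub>R (?u t * h t)"
        using slim by (intro AE_I2 tendsto_intros)
      show "AE t in m. norm (indicator A t *\<^sub>R (s i t * h t)) \<le> cmod (h t)" for i
        using le1 by (intro AE_I2) (auto simp: norm_mult intro!: mult_left_le_one_le split: split_indicator)
    qed (use h A in simp_all)
    also have "(LINT t:A|m. ?u t * h t) = (LINT t:A|m. complex_of_real (cmod (h t)))"
    proof -
      have "cnj (sgn z) * z = complex_of_real (cmod z)" for z
        by (cases "z = 0") (simp_all add: sgn_div_norm scaleR_conv_of_real divide_simps
            complex_norm_square[symmetric] power2_eq_square mult.commute)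
      then show ?thesis by simp
    qed
    finally have "(\<lambda>i. ennreal (cmod (LINT t:A|m. s i t * h t))) \<longlonglongrightarrow>
        ennreal (cmod (LINT t:A|m. complex_of_real (cmod (h t))))"
      by (intro tendsto_intros)
    also have "ennreal (cmod (LINT t:A|m. complex_of_real (cmod (h t)))) = emeasure ?D A"
      unfolding D'[OF A] set_integral_complex_of_real
      by (simp add: set_lebesgue_integral_def)
    finally show ?thesis
      by (rule LIMSEQ_le_const2) (use simple[OF A s] le1 in auto)
  qed
  have "total_variation \<mu> = measure_of UNIV (sets borel) V"
    by (simp add: total_variation_def V_def[abs_def])
  also have "\<dots> = measure_of UNIV (sets borel) (emeasure ?D)"
  proof (rule measure_of_eq)
    fix A :: "'g set" assume "A \<in> sigma_sets UNIV (sets borel)"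
    then have "A \<in> sets m"
      using sets.sigma_sets_eq[of "borel :: 'g measure"] sets_m by simp
    then show "V A = emeasure ?D A" using upper lower by (intro antisym)
  qed simp
  also have "\<dots> = ?D"
    using measure_of_of_measure[of ?D] sets_m sets_eq_imp_space_eq[OF sets_m] by simp
  finally show ?thesis .
qed

section \<open>Scalar densities of an absolutely continuous vector measure\<close>

lemma dual_facts:
  assumes "operator_space X"
  shows csubspace_dual: "csubspace (dual X)"
    and seminorm_on_dual: "seminorm_on (dual X) (dual_norm X)"
    and complete_dual: "complete_space_on (dual X) (dual_norm X)"
    and dual_le: "x' \<in> dual X \<Longrightarrow> x \<in> vecs X \<Longrightarrow> cmod (x' x) \<le> dual_norm X x' * vnorm X x"
proof -
  have V: "csubspace (vecs X)" and p: "seminorm_on (vecs X) (vnorm X)"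
    using assms by (simp_all add: operator_space_def norm_on_vnorm norm_on_imp_seminorm_on)
  show "csubspace (dual X)"
    unfolding dual_def by (rule csubspace_bounded_maps[OF V p])
  show "seminorm_on (dual X) (dual_norm X)"
    unfolding dual_def dual_norm_def by (rule seminorm_on_bounded_maps[OF V p])
  show "complete_space_on (dual X) (dual_norm X)"
    unfolding dual_def dual_norm_def by (rule complete_bounded_maps[OF V p])
  show "cmod (x' x) \<le> dual_norm X x' * vnorm X x" if "x' \<in> dual X" "x \<in> vecs X"
    using functional_le[OF V p] that by (simp add: dual_def dual_norm_def)
qed

lemma dualD:
  assumes "x' \<in> dual X"
  shows dual_add: "x \<in> vecs X \<Longrightarrow> y \<in> vecs X \<Longrightarrow> x' (x + y) = x' x + x' y"
    and dual_scale: "x \<in> vecs X \<Longrightarrow> x' (a *\<^sub>C x) = a * x' x"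
  using assms by (auto simp: dual_def bounded_maps_def clinear_on_def scaleC_complex_def)

lemma dual_diff:
  assumes "operator_space X" "x' \<in> dual X" "x \<in> vecs X" "y \<in> vecs X"
  shows "x' (x - y) = x' x - x' y"
  using dual_add[OF assms(2,3), of "(-1) *\<^sub>C y"] dual_scale[OF assms(2,4), of "-1"]
    complex_vector.subspace_scale[OF csubspace_vecs[OF assms(1)] assms(4), of "-1"] by simp

lemma dual_sum:
  assumes "operator_space X" "x' \<in> dual X" "\<And>i. i \<in> I \<Longrightarrow> f i \<in> vecs X"
  shows "x' (\<Sum>i\<in>I. f i) = (\<Sum>i\<in>I. x' (f i))"
proof -
  have z: "x' 0 = 0"
    using dual_scale[OF assms(2), of 0 0] complex_vector.subspace_0[OF csubspace_vecs[OF assms(1)]]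
    by simp
  show ?thesis
    using assms(3)
  proof (induction I rule: infinite_finite_induct)
    case (insert i I)
    then have "x' (f i + (\<Sum>i\<in>I. f i)) = x' (f i) + x' (\<Sum>i\<in>I. f i)"
      using csubspace_vecs[OF assms(1)]
      by (intro dual_add[OF assms(2)] complex_vector.subspace_sum) auto
    with insert show ?case by simp
  qed (simp_all add: z)
qed

locale ac_vector_measure =
  fixes m :: "'g::topological_space measure" and X :: "'x::complex_vector opspace"
    and \<nu> :: "'g set \<Rightarrow> 'x"
  assumes finite_m: "finite_measure m" and sets_m: "sets m = sets borel"
    and X: "operator_space X" and \<nu>: "\<nu> \<in> Mac m X"
begin

abbreviation h :: "('x \<Rightarrow> complex) \<Rightarrow> 'g \<Rightarrow> complex"
  where "h x' \<equiv> rn_derivative m (scalar_meas \<nu> x')"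

lemma scalar_meas_apply: "scalar_meas \<nu> x' A = x' (\<nu> A)"
  by (simp add: scalar_meas_def)

lemma \<nu>_vecs: "A \<in> sets m \<Longrightarrow> \<nu> A \<in> vecs X"
  using \<nu> by (simp add: Mac_def sets_m)

lemma \<nu>_add:
  fixes A :: "nat \<Rightarrow> 'g set"
  assumes "range A \<subseteq> sets m" "disjoint_family A"
  shows "(\<lambda>n. vnorm X ((\<Sum>k<n. \<nu> (A k)) - \<nu> (\<Union>k. A k))) \<longlonglongrightarrow> 0"
  using \<nu> assms by (simp add: Mac_def sets_m)

sublocale vector_measure "vecs X" "vnorm X" m \<nu>
  by unfold_locales (use csubspace_vecs[OF X] norm_on_vnorm[OF X] \<nu>_vecs \<nu>_add in auto)

lemma \<nu>_null:
  assumes A: "A \<in> null_sets m"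
  shows "\<nu> A = 0"
proof -
  have A': "A \<in> sets m" using A by auto
  have "vnorm X (\<nu> A) < e" if "e > 0" for e
  proof -
    obtain \<delta> where "\<delta> > 0" "\<forall>A\<in>sets borel. measure m A < \<delta> \<longrightarrow> vnorm X (\<nu> A) < e"
      using \<nu> \<open>e > 0\<close> unfolding Mac_def by blast
    moreover have "measure m A = 0" using A by (simp add: measure_def null_setsD1)
    ultimately show ?thesis using A' sets_m by simp
  qed
  then have "\<not> 0 < vnorm X (\<nu> A)" by blast
  then show ?thesis
    using norm \<nu>_vecs[OF A'] unfolding norm_on_def by (metis less_eq_real_def)
qed

lemma scalar_sums:
  assumes x': "x' \<in> dual X" and A: "range A \<subseteq> sets m" "disjoint_family A"
  shows "(\<lambda>k. x' (\<nu> (A k))) sums x' (\<nu> (\<Union>k. A k))"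
proof -
  have AV: "\<nu> (A k) \<in> vecs X" for k using A \<nu>_vecs by blast
  have UV: "\<nu> (\<Union>k. A k) \<in> vecs X" using A by (intro \<nu>_vecs) blast
  have SV: "(\<Sum>k<n. \<nu> (A k)) \<in> vecs X" for n
    using AV by (intro complex_vector.subspace_sum[OF subspace])
  have "(\<lambda>n. (\<Sum>k<n. x' (\<nu> (A k))) - x' (\<nu> (\<Union>k. A k))) \<longlonglongrightarrow> 0"
  proof (rule tendsto_norm_zero_cancel, rule tendsto_sandwich[where f="\<lambda>_. 0"])
    show "\<forall>\<^sub>F n in sequentially. norm ((\<Sum>k<n. x' (\<nu> (A k))) - x' (\<nu> (\<Union>k. A k)))
        \<le> dual_norm X x' * vnorm X ((\<Sum>k<n. \<nu> (A k)) - \<nu> (\<Union>k. A k))"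
      using dual_le[OF X x' complex_vector.subspace_diff[OF subspace SV UV]]
        dual_diff[OF X x' SV UV] by (simp add: dual_sum[OF X x', of "{..<_}" "\<lambda>k. \<nu> (A k)"] AV)
    show "(\<lambda>n. dual_norm X x' * vnorm X ((\<Sum>k<n. \<nu> (A k)) - \<nu> (\<Union>k. A k))) \<longlonglongrightarrow> 0"
      using \<nu>_add[OF A] by (rule tendsto_mult_right_zero)
  qed auto
  then show ?thesis unfolding sums_def by (rule LIM_zero_cancel)
qed

lemma scalar_bound: "\<exists>K\<ge>0. \<forall>x'\<in>dual X. \<forall>A\<in>sets m. cmod (x' (\<nu> A)) \<le> K * dual_norm X x'"
proof -
  obtain K where K: "\<forall>A\<in>sets m. vnorm X (\<nu> A) \<le> K" using bounded_range by blast
  have "0 \<le> vnorm X (\<nu> {})" by (intro seminorm_onD(1)[OF seminorm] \<nu>_vecs) simp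
  also have "\<dots> \<le> K" using K by simp
  finally have K0: "0 \<le> K" .
  have "cmod (x' (\<nu> A)) \<le> K * dual_norm X x'" if "x' \<in> dual X" "A \<in> sets m" for x' A
  proof -
    have "cmod (x' (\<nu> A)) \<le> dual_norm X x' * vnorm X (\<nu> A)"
      using that by (intro dual_le[OF X] \<nu>_vecs)
    also have "\<dots> \<le> dual_norm X x' * K"
      using K that seminorm_onD(1)[OF seminorm_on_dual[OF X]] by (intro mult_left_mono) auto
    finally show ?thesis by (simp add: mult.commute)
  qed
  with K0 show ?thesis by blast
qed

lemma scalar_density:
  assumes x': "x' \<in> dual X"
  shows integrable_h: "integrable m (h x')"
    and scalar_meas_eq: "A \<in> sets m \<Longrightarrow> scalar_meas \<nu> x' A = (LINT t:A|m. h x' t)"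
    and h_eq: "A \<in> sets m \<Longrightarrow> x' (\<nu> A) = (LINT t:A|m. h x' t)"
proof -
  have z: "x' 0 = 0"
    using dual_sum[OF X x', of "{}"] by simp
  obtain K where "\<forall>A\<in>sets m. cmod (x' (\<nu> A)) \<le> K * dual_norm X x'"
    using scalar_bound x' by blast
  then have "\<exists>g. integrable m g \<and> (\<forall>A\<in>sets m. scalar_meas \<nu> x' A = (LINT t:A|m. g t))"
    using scalar_sums[OF x'] z \<nu>_null unfolding scalar_meas_def
    by (intro complex_measure_density[OF finite_m, of _ "K * dual_norm X x'"]) auto
  then have *: "integrable m (h x') \<and> (\<forall>A\<in>sets m. scalar_meas \<nu> x' A = (LINT t:A|m. h x' t))"
    unfolding rn_derivative_def by (rule someI_ex)
  from * show "integrable m (h x')" by blast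
  from * show scalar_meas: "A \<in> sets m \<Longrightarrow> scalar_meas \<nu> x' A = (LINT t:A|m. h x' t)" by blast
  then show "A \<in> sets m \<Longrightarrow> x' (\<nu> A) = (LINT t:A|m. h x' t)"
    unfolding scalar_meas_apply .
qed

lemma h_measurable [measurable]: "x' \<in> dual X \<Longrightarrow> h x' \<in> borel_measurable m"
  by (intro borel_measurable_integrable integrable_h)

lemma h_set_integrable: "x' \<in> dual X \<Longrightarrow> A \<in> sets m \<Longrightarrow> set_integrable m A (h x')"
  unfolding set_integrable_def by (intro integrable_mult_indicator integrable_h)

lemma sigma_finite_m: "sigma_finite_measure m"
  using finite_m by (rule finite_measure.axioms)

lemma h_add:
  assumes "x' \<in> dual X" "y' \<in> dual X"
  shows "AE t in m. h (x' + y') t = h x' t + h y' t"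
proof (rule sigma_finite_measure.density_unique_banach[OF sigma_finite_m])
  have xy: "x' + y' \<in> dual X"
    using csubspace_dual[OF X] assms by (rule complex_vector.subspace_add)
  show "integrable m (h (x' + y'))" using xy by (rule integrable_h)
  show "integrable m (\<lambda>t. h x' t + h y' t)" using assms by (intro Bochner_Integration.integrable_add integrable_h)
  show "(LINT t:A|m. h (x' + y') t) = (LINT t:A|m. h x' t + h y' t)" if "A \<in> sets m" for A
    using h_set_integrable that assms h_eq[OF xy that] h_eq[of x' A] h_eq[of y' A]
    by (simp add: set_integral_add)
qed

lemma h_scale:
  assumes "x' \<in> dual X"
  shows "AE t in m. h (a *\<^sub>C x') t = a * h x' t"
proof (rule sigma_finite_measure.density_unique_banach[OF sigma_finite_m])
  have ax: "a *\<^sub>C x' \<in> dual X"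
    using csubspace_dual[OF X] assms by (rule complex_vector.subspace_scale)
  show "integrable m (h (a *\<^sub>C x'))" using ax by (rule integrable_h)
  show "integrable m (\<lambda>t. a * h x' t)" using assms by (intro integrable_mult_right integrable_h)
  show "(LINT t:A|m. h (a *\<^sub>C x') t) = (LINT t:A|m. a * h x' t)" if "A \<in> sets m" for A
    using h_eq[OF ax that] h_eq[OF assms that] by (simp add: scaleC_fun_def scaleC_complex_def)
qed

text \<open>The integral of the positive part of \<open>\<plusminus> Re (h x')\<close> or \<open>\<plusminus> Im (h x')\<close> is, up to sign, the real or imaginary
part of \<open>x' (\<nu> A)\<close> for a single set \<open>A\<close>, so each of the four contributes at most \<open>sup |x' (\<nu> A)|\<close>; whence the factor 4.\<close>

lemma h_L1_bound: "\<exists>K\<ge>0. \<forall>x'\<in>dual X. (\<integral>t. cmod (h x' t) \<partial>m) \<le> K * dual_norm X x'"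
proof -
  obtain K where K0: "K \<ge> 0" and K: "\<And>x' A. x' \<in> dual X \<Longrightarrow> A \<in> sets m \<Longrightarrow> cmod (x' (\<nu> A)) \<le> K * dual_norm X x'"
    using scalar_bound by blast
  have "(\<integral>t. cmod (h x' t) \<partial>m) \<le> (4 * K) * dual_norm X x'" if x': "x' \<in> dual X" for x'
  proof -
    let ?N = "K * dual_norm X x'"
    have N0: "0 \<le> ?N" using K0 seminorm_onD(1)[OF seminorm_on_dual[OF X] x'] by simp
    note [measurable] = h_measurable[OF x']
    (* the real function T (h x') is integrated over the set where it is positive *)
    have part: "(\<integral>t. max 0 (T (h x' t)) \<partial>m) \<le> ?N"
      if T: "bounded_linear T" "\<And>z. T z \<le> cmod z" for T :: "complex \<Rightarrow> real"
    proof -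
      have [measurable]: "T \<in> borel_measurable borel"
        using T(1) by (intro borel_measurable_continuous_onI linear_continuous_on)
      define A where "A = {t \<in> space m. 0 \<le> T (h x' t)}"
      have A: "A \<in> sets m" unfolding A_def by measurable
      interpret T: bounded_linear T by fact
      have "(\<integral>t. max 0 (T (h x' t)) \<partial>m) = (\<integral>t. T (indicator A t *\<^sub>R h x' t) \<partial>m)"
        by (intro Bochner_Integration.integral_cong)
          (auto simp: A_def max_def T.zero split: split_indicator)
      also have "\<dots> = T (LINT t:A|m. h x' t)"
        unfolding set_lebesgue_integral_def
        using integral_bounded_linear[OF T(1) h_set_integrable[OF x' A, unfolded set_integrable_def]] .
      also have "\<dots> \<le> cmod (x' (\<nu> A))" using T(2) h_eq[OF x' A] by simp
      also have "\<dots> \<le> ?N" using x' A by (rule K)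
      finally show ?thesis .
    qed
    have Re: "integrable m (\<lambda>t. max 0 (Re (h x' t)))" "integrable m (\<lambda>t. max 0 (- Re (h x' t)))"
      and Im: "integrable m (\<lambda>t. max 0 (Im (h x' t)))" "integrable m (\<lambda>t. max 0 (- Im (h x' t)))"
      using integrable_h[OF x'] by auto
    have "(\<integral>t. cmod (h x' t) \<partial>m) \<le> (\<integral>t. (max 0 (Re (h x' t)) + max 0 (- Re (h x' t)))
        + (max 0 (Im (h x' t)) + max 0 (- Im (h x' t))) \<partial>m)"
    proof (rule integral_mono)
      fix t
      show "cmod (h x' t) \<le> max 0 (Re (h x' t)) + max 0 (- Re (h x' t))
        + (max 0 (Im (h x' t)) + max 0 (- Im (h x' t)))"
        using cmod_le[of "h x' t"] by linarith
    qed (use Re Im integrable_h[OF x'] in auto)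
    also have "\<dots> = (\<integral>t. max 0 (Re (h x' t)) \<partial>m) + (\<integral>t. max 0 (- Re (h x' t)) \<partial>m)
        + ((\<integral>t. max 0 (Im (h x' t)) \<partial>m) + (\<integral>t. max 0 (- Im (h x' t)) \<partial>m))"
      using Re Im by simp
    also have "\<dots> \<le> (?N + ?N) + (?N + ?N)"
    proof (intro add_mono)
      have "- Re z \<le> cmod z" "- Im z \<le> cmod z" "Im z \<le> cmod z" for z
        using abs_Re_le_cmod[of z] abs_Im_le_cmod[of z] by linarith+
      then show "(\<integral>t. max 0 (Re (h x' t)) \<partial>m) \<le> ?N" "(\<integral>t. max 0 (- Re (h x' t)) \<partial>m) \<le> ?N"
        "(\<integral>t. max 0 (Im (h x' t)) \<partial>m) \<le> ?N" "(\<integral>t. max 0 (- Im (h x' t)) \<partial>m) \<le> ?N"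
        using part[of Re] part[of "\<lambda>z. - Re z"] part[of Im] part[of "\<lambda>z. - Im z"]
        by (simp_all add: bounded_linear_Re bounded_linear_Im bounded_linear_minus complex_Re_le_cmod)
    qed
    finally show ?thesis by simp
  qed
  with K0 show ?thesis by (intro exI[of _ "4 * K"]) auto
qed

end

context ac_vector_measure begin

section \<open>The weak norm\<close>

lemma total_variation_h:
  "x' \<in> dual X \<Longrightarrow> total_variation (scalar_meas \<nu> x') = density m (\<lambda>t. ennreal (cmod (h x' t)))"
  by (intro total_variation_eq_density sets_m integrable_h scalar_meas_eq)

lemma L1w_measurable:
  assumes "f \<in> vecs (L1w X \<nu>)"
  shows "f \<in> borel_measurable m"
proof -
  have "0 \<in> dual X" by (rule complex_vector.subspace_0[OF csubspace_dual[OF X]])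
  then have "integrable (density m (\<lambda>t. ennreal (cmod (h 0 t)))) f"
    using assms total_variation_h by (simp add: L1w_def)
  then have "f \<in> borel_measurable (density m (\<lambda>t. ennreal (cmod (h 0 t))))" by (rule borel_measurable_integrable)
  then show ?thesis by simp
qed

lemma L1w_integrable:
  assumes "f \<in> vecs (L1w X \<nu>)" "x' \<in> dual X"
  shows "integrable m (\<lambda>t. f t * h x' t)"
proof -
  have [measurable]: "f \<in> borel_measurable m" "h x' \<in> borel_measurable m"
    using assms L1w_measurable h_measurable by auto
  have "integrable (density m (\<lambda>t. ennreal (cmod (h x' t)))) f"
    using assms total_variation_h by (simp add: L1w_def)
  then have "integrable m (\<lambda>t. cmod (h x' t) *\<^sub>R f t)"
    by (subst (asm) integrable_density) auto
  then show ?thesis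
    by (rule Bochner_Integration.integrable_bound) (auto simp: norm_mult)
qed

lemma integral_total_variation:
  assumes "f \<in> borel_measurable m" "x' \<in> dual X"
  shows "(\<integral>t. cmod (f t) \<partial>total_variation (scalar_meas \<nu> x')) = (\<integral>t. cmod (f t * h x' t) \<partial>m)"
proof -
  have [measurable]: "f \<in> borel_measurable m" "h x' \<in> borel_measurable m"
    using assms h_measurable by auto
  show ?thesis
    unfolding total_variation_h[OF assms(2)] by (subst integral_density) (auto simp: norm_mult mult.commute)
qed

lemma csubspace_L1w: "csubspace (vecs (L1w X \<nu>))"
  by (rule complex_vector.subspaceI)
    (auto simp: L1w_def plus_fun_def zero_fun_def scaleC_fun_def scaleC_complex_def)

text \<open>The truncations \<open>min |f| k\<close> are bounded functions, so that \<open>x' \<mapsto> \<integral> min |f| k |h x'| dm\<close> is a seminorm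
bounded by a multiple of the dual norm. For fixed \<open>x'\<close> these seminorms are bounded in \<open>k\<close> by
\<open>\<integral> |f| |h x'| dm\<close>, so uniform boundedness yields a constant that is independent of \<open>k\<close>, and \<open>k\<close> tends
to infinity by dominated convergence.\<close>

lemma weak_norm_bounded:
  assumes f: "f \<in> vecs (L1w X \<nu>)"
  shows "\<exists>C. \<forall>x'\<in>dual X. (\<integral>t. cmod (f t) \<partial>total_variation (scalar_meas \<nu> x')) \<le> C * dual_norm X x'"
proof -
  note [measurable] = L1w_measurable[OF f]
  define g where "g k t = min (cmod (f t)) (real k)" for k t
  define q where "q k x' = (\<integral>t. g k t * cmod (h x' t) \<partial>m)" for k x'
  have g_meas [measurable]: "g k \<in> borel_measurable m" for k unfolding g_def by measurable
  have g0: "0 \<le> g k t" and gk: "g k t \<le> real k" and gf: "g k t \<le> cmod (f t)" for k t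
    by (auto simp: g_def)
  have gh: "integrable m (\<lambda>t. g k t * cmod (h x' t))" if "x' \<in> dual X" for k x'
  proof (rule Bochner_Integration.integrable_bound)
    show "integrable m (\<lambda>t. real k * cmod (h x' t))" using integrable_h[OF that] by simp
    show "AE t in m. norm (g k t * cmod (h x' t)) \<le> norm (real k * cmod (h x' t))"
      using g0 gk by (auto simp: abs_mult intro!: mult_right_mono)
    show "(\<lambda>t. g k t * cmod (h x' t)) \<in> borel_measurable m" using h_measurable[OF that] by measurable
  qed
  have "\<exists>C. \<forall>k\<in>UNIV. \<forall>x'\<in>dual X. q k x' \<le> C * dual_norm X x'"
  proof (rule uniform_boundedness[OF csubspace_dual[OF X] seminorm_on_dual[OF X] complete_dual[OF X]])
    fix k :: nat
    show "seminorm_on (dual X) (q k)"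
      unfolding seminorm_on_def
    proof (intro conjI ballI allI)
      fix x' assume x': "x' \<in> dual X"
      show "0 \<le> q k x'" using g0 by (simp add: q_def)
      fix y' assume y': "y' \<in> dual X"
      have "q k (x' + y') \<le> (\<integral>t. g k t * cmod (h x' t) + g k t * cmod (h y' t) \<partial>m)"
        unfolding q_def
      proof (rule integral_mono_AE)
        show "AE t in m. g k t * cmod (h (x' + y') t) \<le> g k t * cmod (h x' t) + g k t * cmod (h y' t)"
          using h_add[OF x' y']
          by eventually_elim (simp add: g0 norm_triangle_ineq mult_left_mono flip: distrib_left)
      qed (use gh x' y' complex_vector.subspace_add[OF csubspace_dual[OF X]] in auto)
      also have "\<dots> = q k x' + q k y'" unfolding q_def using gh x' y' by simp
      finally show "q k (x' + y') \<le> q k x' + q k y'" .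
    next
      fix a x' assume x': "x' \<in> dual X"
      have "q k (a *\<^sub>C x') = (\<integral>t. cmod a * (g k t * cmod (h x' t)) \<partial>m)"
        unfolding q_def
      proof (rule integral_cong_AE)
        show "AE t in m. g k t * cmod (h (a *\<^sub>C x') t) = cmod a * (g k t * cmod (h x' t))"
          using h_scale[OF x', of a] by eventually_elim (simp add: norm_mult)
        have "a *\<^sub>C x' \<in> dual X" using csubspace_dual[OF X] x' by (rule complex_vector.subspace_scale)
        note [measurable] = h_measurable[OF this] h_measurable[OF x']
        show "(\<lambda>t. g k t * cmod (h (a *\<^sub>C x') t)) \<in> borel_measurable m"
          "(\<lambda>t. cmod a * (g k t * cmod (h x' t))) \<in> borel_measurable m" by measurable
      qed
      then show "q k (a *\<^sub>C x') = cmod a * q k x'" by (simp add: q_def)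
    qed
    obtain K where K: "K \<ge> 0" "\<forall>x'\<in>dual X. (\<integral>t. cmod (h x' t) \<partial>m) \<le> K * dual_norm X x'"
      using h_L1_bound by blast
    have "q k x' \<le> (real k * K) * dual_norm X x'" if x': "x' \<in> dual X" for x'
    proof -
      have "q k x' \<le> (\<integral>t. real k * cmod (h x' t) \<partial>m)"
        unfolding q_def using g0 gk gh[OF x'] integrable_h[OF x']
        by (intro integral_mono) (auto intro!: mult_right_mono)
      also have "\<dots> \<le> real k * (K * dual_norm X x')" using K x' by (simp add: mult_left_mono)
      finally show ?thesis by (simp add: mult.assoc)
    qed
    then show "\<exists>C. \<forall>x'\<in>dual X. q k x' \<le> C * dual_norm X x'" by blast
  next
    fix x' assume x': "x' \<in> dual X"
    have "q k x' \<le> (\<integral>t. cmod (f t * h x' t) \<partial>m)" for k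
      unfolding q_def using gf gh[OF x'] integrable_norm[OF L1w_integrable[OF f x']]
      by (intro integral_mono) (simp_all add: norm_mult mult_right_mono)
    then show "\<exists>B. \<forall>k\<in>UNIV. q k x' \<le> B" by blast
  qed
  then obtain C where C: "\<And>k x'. x' \<in> dual X \<Longrightarrow> q k x' \<le> C * dual_norm X x'" by blast
  have "(\<integral>t. cmod (f t) \<partial>total_variation (scalar_meas \<nu> x')) \<le> C * dual_norm X x'" if x': "x' \<in> dual X" for x'
  proof (rule LIMSEQ_le_const2)
    note [measurable] = h_measurable[OF x']
    show "(\<lambda>k. q k x') \<longlonglongrightarrow> (\<integral>t. cmod (f t) \<partial>total_variation (scalar_meas \<nu> x'))"
      unfolding integral_total_variation[OF L1w_measurable[OF f] x'] q_def
    proof (rule integral_dominated_convergence)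
      show "integrable m (\<lambda>t. cmod (f t * h x' t))" using L1w_integrable[OF f x'] by (rule integrable_norm)
      show "AE t in m. norm (g k t * cmod (h x' t)) \<le> cmod (f t * h x' t)" for k
        using g0 gf by (auto simp: abs_mult norm_mult intro!: mult_right_mono)
      have "(\<lambda>k. g k t * cmod (h x' t)) \<longlonglongrightarrow> cmod (f t * h x' t)" for t
      proof (rule tendsto_eventually)
        obtain k0 where "cmod (f t) \<le> real k0" using real_arch_simple by blast
        then have "g k t = cmod (f t)" if "k \<ge> k0" for k
          using that by (simp add: g_def min_def)
        then show "\<forall>\<^sub>F k in sequentially. g k t * cmod (h x' t) = cmod (f t * h x' t)"
          unfolding eventually_sequentially by (auto simp: norm_mult)
      qed
      then show "AE t in m. (\<lambda>k. g k t * cmod (h x' t)) \<longlonglongrightarrow> cmod (f t * h x' t)" by simp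
    qed (use h_measurable[OF x'] in measurable)
  qed (use C[OF x'] in blast)
  then show ?thesis by blast
qed

lemma weak_norm_eq_map_norm:
  "weak_norm X \<nu> f = map_norm (dual X) (dual_norm X) (\<lambda>r. r)
     (\<lambda>x'. \<integral>t. cmod (f t) \<partial>total_variation (scalar_meas \<nu> x'))"
  by (simp add: weak_norm_def map_norm_def dual_ball_def)

text \<open>The supremum in \<open>weak_norm\<close> is taken in the reals, so that \<open>weak_norm_bounded\<close> is what makes it an
upper bound.\<close>

lemma integral_le_weak_norm:
  assumes f: "f \<in> vecs (L1w X \<nu>)" and x': "x' \<in> dual X"
  shows "(\<integral>t. cmod (f t * h x' t) \<partial>m) \<le> weak_norm X \<nu> f * dual_norm X x'"
proof -
  note fm = L1w_measurable[OF f]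
  have scale: "(\<integral>t. cmod (f t) \<partial>total_variation (scalar_meas \<nu> (a *\<^sub>C y')))
      = cmod a * (\<integral>t. cmod (f t) \<partial>total_variation (scalar_meas \<nu> y'))" if y': "y' \<in> dual X" for a y'
  proof -
    have ay: "a *\<^sub>C y' \<in> dual X" using csubspace_dual[OF X] y' by (rule complex_vector.subspace_scale)
    note [measurable] = fm h_measurable[OF ay] h_measurable[OF y']
    have "(\<integral>t. cmod (f t * h (a *\<^sub>C y') t) \<partial>m) = (\<integral>t. cmod a * cmod (f t * h y' t) \<partial>m)"
    proof (rule integral_cong_AE)
      show "AE t in m. cmod (f t * h (a *\<^sub>C y') t) = cmod a * cmod (f t * h y' t)"
        using h_scale[OF y', of a] by eventually_elim (simp add: norm_mult mult_ac)
    qed measurable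
    then show ?thesis by (simp add: integral_total_variation[OF fm] ay y')
  qed
  show ?thesis
    using le_map_norm[OF csubspace_dual[OF X] seminorm_on_dual[OF X], where q="\<lambda>r. r"
        and T="\<lambda>x'. \<integral>t. cmod (f t) \<partial>total_variation (scalar_meas \<nu> x')", OF scale weak_norm_bounded[OF f] x']
    by (simp add: weak_norm_eq_map_norm integral_total_variation[OF fm x'])
qed

lemma weak_norm_nonneg:
  assumes f: "f \<in> vecs (L1w X \<nu>)"
  shows "0 \<le> weak_norm X \<nu> f"
proof -
  have 0: "0 \<in> dual X" by (rule complex_vector.subspace_0[OF csubspace_dual[OF X]])
  have "0 \<in> {x' \<in> dual X. dual_norm X x' \<le> 1}"
    using 0 seminorm_onD(5)[OF seminorm_on_dual[OF X] 0] by simp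
  then have "(\<integral>t. cmod (f t) \<partial>total_variation (scalar_meas \<nu> (0 :: 'x \<Rightarrow> complex))) \<le> weak_norm X \<nu> f"
    unfolding weak_norm_def dual_ball_def
    using weak_norm_bounded[OF f] seminorm_onD(1)[OF seminorm_on_dual[OF X]]
    by (intro cSUP_upper[where x=0 and A="{x' \<in> dual X. dual_norm X x' \<le> 1}"] bdd_above_map_norm[where q="\<lambda>r. r" and p="dual_norm X"]) auto
  moreover have "0 \<le> (\<integral>t. cmod (f t) \<partial>total_variation (scalar_meas \<nu> 0))" by simp
  ultimately show ?thesis by linarith
qed

end

section \<open>Operator norms of matrices\<close>

definition l2 :: "nat \<Rightarrow> (nat \<Rightarrow> complex) \<Rightarrow> real"
  where "l2 n v = L2_set (\<lambda>j. cmod (v j)) {..<n}"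

text \<open>The form \<open>\<langle>A v, w\<rangle>\<close>. Operator norms are estimated through it because it is linear in \<open>A\<close> and hence
commutes with integration and with splitting a matrix into blocks.\<close>

definition pairing ::
  "nat \<Rightarrow> nat \<Rightarrow> (nat \<Rightarrow> complex) \<Rightarrow> (nat \<Rightarrow> nat \<Rightarrow> complex) \<Rightarrow> (nat \<Rightarrow> complex) \<Rightarrow> complex"
  where "pairing m n w A v = (\<Sum>i<m. \<Sum>j<n. cnj (w i) * A i j * v j)"

lemma l2_nonneg: "0 \<le> l2 n v"
  by (simp add: l2_def)

lemma l2_scale: "l2 n (\<lambda>j. c * v j) = cmod c * l2 n v"
  by (simp add: l2_def norm_mult L2_set_right_distrib)

lemma l2_coord_le: "j < n \<Longrightarrow> cmod (v j) \<le> l2 n v"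
  unfolding l2_def by (rule member_le_L2_set) auto

lemma l2_eq_0: "l2 n v = 0 \<Longrightarrow> j < n \<Longrightarrow> v j = 0"
  using l2_coord_le[of j n v] by simp

lemma l2_power2: "(l2 n v)\<^sup>2 = (\<Sum>j<n. (cmod (v j))\<^sup>2)"
  by (simp add: l2_def L2_set_def sum_nonneg)

lemma norm_sum_cnj_le: "cmod (\<Sum>i<n. cnj (w i) * u i) \<le> l2 n w * l2 n u"
proof -
  have "cmod (\<Sum>i<n. cnj (w i) * u i) \<le> (\<Sum>i<n. \<bar>cmod (w i)\<bar> * \<bar>cmod (u i)\<bar>)"
    by (rule order_trans[OF norm_sum]) (simp add: norm_mult)
  also have "\<dots> \<le> l2 n w * l2 n u" unfolding l2_def by (rule L2_set_mult_ineq)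
  finally show ?thesis .
qed

text \<open>The choice \<open>w = u\<close> gives \<open>\<parallel>u\<parallel>\<^sup>2 \<le> C \<parallel>u\<parallel>\<close>.\<close>

lemma l2_dual_le:
  assumes "0 \<le> C" "\<And>w. cmod (\<Sum>i<n. cnj (w i) * u i) \<le> C * l2 n w"
  shows "l2 n u \<le> C"
proof (cases "l2 n u = 0")
  case False
  have "(\<Sum>i<n. cnj (u i) * u i) = complex_of_real ((l2 n u)\<^sup>2)"
    unfolding l2_power2 of_real_sum complex_norm_square by (simp add: mult.commute)
  then have "l2 n u * l2 n u \<le> C * l2 n u"
    using assms(2)[of u] by (simp add: power2_eq_square norm_mult l2_nonneg)
  then show ?thesis using False l2_nonneg[of n u] by (simp add: mult_le_cancel_right)
qed (use assms in simp)

lemma seminorm_on_l2: "seminorm_on UNIV (l2 n)"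
proof -
  have "l2 n (\<lambda>j. v j + w j) \<le> l2 n v + l2 n w" for v w
    unfolding l2_def
    by (rule order_trans[OF L2_set_mono L2_set_triangle_ineq]) (auto intro: norm_triangle_ineq)
  then show ?thesis
    by (simp add: seminorm_on_def l2_nonneg l2_scale scaleC_fun_def scaleC_complex_def plus_fun_def)
qed

lemma pairing_eq_mat_vec: "pairing m n w A v = (\<Sum>i<m. cnj (w i) * mat_vec n A v i)"
  by (simp add: pairing_def mat_vec_def sum_distrib_left mult.assoc)

lemma pairing_normalize:
  "pairing m n w A v = complex_of_real (l2 m w * l2 n v) *
     pairing m n (\<lambda>i. w i / complex_of_real (l2 m w)) A (\<lambda>j. v j / complex_of_real (l2 n v))"
proof -
  have "cnj (w i) * A i j * v j = complex_of_real (l2 m w * l2 n v) *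
      (cnj (w i / complex_of_real (l2 m w)) * A i j * (v j / complex_of_real (l2 n v)))"
    if "i < m" "j < n" for i j
  proof (cases "l2 m w = 0 \<or> l2 n v = 0")
    case True
    then show ?thesis using l2_eq_0[of m w i] l2_eq_0[of n v j] that by auto
  next
    case False
    then show ?thesis by simp
  qed
  then show ?thesis
    unfolding pairing_def sum_distrib_left by (intro sum.cong) auto
qed

lemma l2_normalized: "l2 n (\<lambda>j. v j / complex_of_real (l2 n v)) \<le> 1"
  using l2_scale[of n "1 / complex_of_real (l2 n v)" v] l2_nonneg[of n v]
  by (cases "l2 n v = 0") (simp_all add: norm_divide)

lemma norm_pairing_le_sum:
  "cmod (pairing m n w A v) \<le> (\<Sum>i<m. \<Sum>j<n. cmod (A i j)) * l2 m w * l2 n v"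
proof -
  have "cmod (pairing m n w A v) \<le> (\<Sum>i<m. \<Sum>j<n. cmod (cnj (w i) * A i j * v j))"
    unfolding pairing_def by (intro order_trans[OF norm_sum] sum_mono order_refl norm_sum)
  also have "\<dots> \<le> (\<Sum>i<m. \<Sum>j<n. cmod (A i j) * (l2 m w * l2 n v))"
  proof (intro sum_mono)
    fix i j assume "i \<in> {..<m}" "j \<in> {..<n}"
    then have "cmod (w i) * cmod (v j) \<le> l2 m w * l2 n v"
      by (intro mult_mono l2_coord_le) (auto simp: l2_nonneg)
    from mult_left_mono[OF this, of "cmod (A i j)"]
    show "cmod (cnj (w i) * A i j * v j) \<le> cmod (A i j) * (l2 m w * l2 n v)"
      by (simp add: norm_mult mult_ac)
  qed
  also have "\<dots> = (\<Sum>i<m. \<Sum>j<n. cmod (A i j)) * l2 m w * l2 n v"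
    by (simp add: sum_distrib_right mult.assoc)
  finally show ?thesis .
qed

lemma op_norm_eq_map_norm: "op_norm m n A = map_norm UNIV (l2 n) (l2 m) (mat_vec n A)"
  by (simp add: op_norm_def map_norm_def l2_def[abs_def])

lemma l2_mat_vec_le_sum: "l2 m (mat_vec n A v) \<le> (\<Sum>i<m. \<Sum>j<n. cmod (A i j)) * l2 n v"
  using norm_pairing_le_sum[of m n _ A v]
  by (intro l2_dual_le) (auto simp: pairing_eq_mat_vec mult_ac intro!: mult_nonneg_nonneg sum_nonneg l2_nonneg)

lemma mat_vec_bounded: "\<exists>C. \<forall>v\<in>UNIV. l2 m (mat_vec n A v) \<le> C * l2 n v"
  using l2_mat_vec_le_sum by blast

lemma op_norm_le:
  assumes "0 \<le> C" "\<And>w v. cmod (pairing m n w A v) \<le> C * l2 m w * l2 n v"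
  shows "op_norm m n A \<le> C"
  unfolding op_norm_eq_map_norm
proof (rule map_norm_le)
  show "l2 m (mat_vec n A v) \<le> C * l2 n v" for v
    using assms by (intro l2_dual_le) (auto simp: pairing_eq_mat_vec[symmetric] l2_nonneg mult_ac)
qed (use assms seminorm_on_l2 in auto)

lemma norm_pairing_le: "cmod (pairing m n w A v) \<le> op_norm m n A * l2 m w * l2 n v"
proof -
  have "mat_vec n A (a *\<^sub>C v) = (\<lambda>i. a * mat_vec n A v i)" for a v
    by (simp add: mat_vec_def scaleC_fun_def scaleC_complex_def sum_distrib_left mult_ac)
  then have "l2 m (mat_vec n A v) \<le> op_norm m n A * l2 n v"
    unfolding op_norm_eq_map_norm
    by (intro le_map_norm seminorm_on_l2 mat_vec_bounded) (auto simp: l2_scale)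
  from mult_left_mono[OF this l2_nonneg[of m w]] show ?thesis
    unfolding pairing_eq_mat_vec
    by (intro order_trans[OF norm_sum_cnj_le]) (simp add: mult_ac)
qed

lemma op_norm_nonneg: "0 \<le> op_norm m n A"
proof -
  have "l2 m (mat_vec n A 0) = 0" by (simp add: mat_vec_def l2_def L2_set_def)
  then show ?thesis
    unfolding op_norm_eq_map_norm
    by (intro map_norm_nonneg seminorm_on_l2 mat_vec_bounded) auto
qed

lemma op_norm_le_sum: "op_norm m n A \<le> (\<Sum>i<m. \<Sum>j<n. cmod (A i j))"
  by (intro op_norm_le norm_pairing_le_sum sum_nonneg) auto

lemma op_norm_cong:
  assumes "\<And>i j. i < m \<Longrightarrow> j < n \<Longrightarrow> A i j = B i j"
  shows "op_norm m n A = op_norm m n B"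
proof -
  have "pairing m n w A v = pairing m n w B v" for w v
    unfolding pairing_def using assms by (intro sum.cong) auto
  with norm_pairing_le[of m n _ A] norm_pairing_le[of m n _ B] show ?thesis
    by (intro antisym op_norm_le op_norm_nonneg) metis+
qed

lemma seminorm_on_op_norm: "seminorm_on UNIV (op_norm m n)"
proof -
  have le: "op_norm m n (a *\<^sub>C A) \<le> cmod a * op_norm m n A" for a A
  proof (rule op_norm_le)
    have "pairing m n w (a *\<^sub>C A) v = a * pairing m n w A v" for w v
      by (simp add: pairing_def scaleC_fun_def scaleC_complex_def sum_distrib_left mult_ac)
    then show "cmod (pairing m n w (a *\<^sub>C A) v) \<le> cmod a * op_norm m n A * l2 m w * l2 n v" for w v
      using mult_left_mono[OF norm_pairing_le[of m n w A v], of "cmod a"] by (simp add: norm_mult mult.assoc)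
  qed (simp add: op_norm_nonneg)
  have "op_norm m n (a *\<^sub>C A) = cmod a * op_norm m n A" for a A
  proof (cases "a = 0")
    case True
    then show ?thesis using le[of a A] op_norm_nonneg[of m n "a *\<^sub>C A"] by simp
  next
    case False
    with le[of "inverse a" "a *\<^sub>C A"] have "op_norm m n A \<le> inverse (cmod a) * op_norm m n (a *\<^sub>C A)"
      by (simp add: norm_inverse)
    with le[of a A] False show ?thesis by (simp add: field_simps)
  qed
  moreover have "op_norm m n (A + B) \<le> op_norm m n A + op_norm m n B" for A B
  proof (rule op_norm_le)
    have "pairing m n w (A + B) v = pairing m n w A v + pairing m n w B v" for w v
      by (simp add: pairing_def algebra_simps sum.distrib)
    then show "cmod (pairing m n w (A + B) v) \<le> (op_norm m n A + op_norm m n B) * l2 m w * l2 n v" for w v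
      using norm_triangle_mono[OF norm_pairing_le[of m n w A v] norm_pairing_le[of m n w B v]]
      by (simp add: algebra_simps)
  qed (simp add: op_norm_nonneg)
  ultimately show ?thesis by (simp add: seminorm_on_def op_norm_nonneg)
qed

text \<open>An index \<open>r < n * d\<close> is \<open>i * d + k\<close>, where \<open>i < n\<close> is the place in \<open>M\<^sub>n\<close> and \<open>k < d\<close> the place in
\<open>M\<^sub>d\<close>. Grouping by \<open>k\<close> turns an element of \<open>M\<^sub>n(M\<^sub>d)\<close> into a \<open>d \<times> d\<close> matrix of \<open>n \<times> n\<close> blocks.\<close>

lemma sum_blocks: "(\<Sum>r<n * d. g r) = (\<Sum>k<d. \<Sum>i<n. g (i * d + k))" for d :: nat
proof -
  have "(\<Sum>r<n * d. g r) = (\<Sum>i<n. sum g {i * d..<i * d + d})"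
    by (rule sum.nat_group[symmetric])
  also have "\<dots> = (\<Sum>i<n. \<Sum>k<d. g (i * d + k))"
  proof (rule sum.cong[OF refl])
    fix i
    show "sum g {i * d..<i * d + d} = (\<Sum>k<d. g (i * d + k))"
      using sum.atLeastLessThan_shift_0[of g "i * d" "i * d + d"] by (simp add: lessThan_atLeast0)
  qed
  finally show ?thesis by (subst sum.swap) simp
qed

lemma sum_l2_blocks_le: "(\<Sum>k<d. l2 n (\<lambda>i. W (i * d + k))) \<le> sqrt d * l2 (n * d) W"
proof -
  have "(\<Sum>k<d. \<bar>1\<bar> * \<bar>l2 n (\<lambda>i. W (i * d + k))\<bar>)
      \<le> L2_set (\<lambda>_. 1) {..<d} * L2_set (\<lambda>k. l2 n (\<lambda>i. W (i * d + k))) {..<d}"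
    by (rule L2_set_mult_ineq)
  moreover have "L2_set (\<lambda>k. l2 n (\<lambda>i. W (i * d + k))) {..<d} = l2 (n * d) W"
  proof -
    have "(\<Sum>k<d. (l2 n (\<lambda>i. W (i * d + k)))\<^sup>2) = (\<Sum>r<n * d. (cmod (W r))\<^sup>2)"
      by (simp only: l2_power2 sum_blocks[where n=n and d=d])
    then show ?thesis by (simp only: l2_def L2_set_def)
  qed
  ultimately show ?thesis by (simp add: l2_nonneg L2_set_constant)
qed

text \<open>With \<open>W\<^sub>k\<close> and \<open>V\<^sub>l\<close> the parts of \<open>W\<close> and \<open>V\<close> that belong to the blocks,
\<open>|\<langle>B V, W\<rangle>| \<le> K (\<Sum>\<^sub>k \<parallel>W\<^sub>k\<parallel>) (\<Sum>\<^sub>l \<parallel>V\<^sub>l\<parallel>)\<close>, and by the Cauchy--Schwarz inequality each of the two sums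
is at most \<open>sqrt d\<close> times the norm of the whole vector.\<close>

lemma op_norm_blocks_le:
  assumes K: "0 \<le> K"
    and B: "\<And>k l w v. k < d \<Longrightarrow> l < d \<Longrightarrow>
      cmod (pairing n n w (\<lambda>i j. B (i * d + k) (j * d + l)) v) \<le> K * l2 n w * l2 n v"
  shows "op_norm (n * d) (n * d) B \<le> real d * K"
proof (rule op_norm_le)
  fix W V :: "nat \<Rightarrow> complex"
  let ?w = "\<lambda>k i. W (i * d + k)" and ?v = "\<lambda>l j. V (j * d + l)"
  have "pairing (n * d) (n * d) W B V
      = (\<Sum>k<d. \<Sum>i<n. \<Sum>l<d. \<Sum>j<n. cnj (?w k i) * B (i * d + k) (j * d + l) * ?v l j)"
    unfolding pairing_def sum_blocks[where n=n and d=d] ..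
  also have "\<dots> = (\<Sum>k<d. \<Sum>l<d. pairing n n (?w k) (\<lambda>i j. B (i * d + k) (j * d + l)) (?v l))"
    unfolding pairing_def by (rule sum.cong[OF refl], rule sum.swap)
  finally have blocks: "pairing (n * d) (n * d) W B V
      = (\<Sum>k<d. \<Sum>l<d. pairing n n (?w k) (\<lambda>i j. B (i * d + k) (j * d + l)) (?v l))" .
  have "cmod (pairing (n * d) (n * d) W B V) \<le> (\<Sum>k<d. \<Sum>l<d. K * l2 n (?w k) * l2 n (?v l))"
    unfolding blocks
    by (rule order_trans[OF norm_sum], rule sum_mono, rule order_trans[OF norm_sum], rule sum_mono)
      (simp add: B)
  also have "\<dots> = K * ((\<Sum>k<d. l2 n (?w k)) * (\<Sum>l<d. l2 n (?v l)))"
    by (simp only: sum_product sum_distrib_left[of K] mult.assoc)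
  also have "\<dots> \<le> K * ((sqrt d * l2 (n * d) W) * (sqrt d * l2 (n * d) V))"
    using K by (intro mult_left_mono mult_mono sum_l2_blocks_le)
      (auto intro!: sum_nonneg mult_nonneg_nonneg simp: l2_nonneg)
  also have "\<dots> = (sqrt d * sqrt d) * K * l2 (n * d) W * l2 (n * d) V" by (simp only: mult_ac)
  finally show "cmod (pairing (n * d) (n * d) W B V) \<le> real d * K * l2 (n * d) W * l2 (n * d) V"
    unfolding real_sqrt_mult_self abs_of_nat .
qed (use K in simp)

lemma vnorm_mat_opspace: "vnorm (mat_opspace n) A = op_norm n n A"
  by (simp add: vnorm_def mat_opspace_def) (rule op_norm_cong, simp)

lemma vecs_mat_opspace: "vecs (mat_opspace n) = matrices n n UNIV"
  by (simp add: mat_opspace_def)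

lemma csubspace_matrices: "csubspace (matrices n n (UNIV :: complex set))"
  by (rule complex_vector.subspaceI) (auto simp: matrices_def scaleC_fun_def scaleC_complex_def)

lemma seminorm_on_mat_opspace:
  "seminorm_on (vecs (mat_opspace n)) (vnorm (mat_opspace n))"
  using seminorm_on_op_norm[of n n] by (simp add: seminorm_on_def vnorm_mat_opspace)

lemma mat_dual_ball_le:
  assumes "y' \<in> dual_ball (mat_opspace n)" "A \<in> matrices n n UNIV"
  shows "cmod (y' A) \<le> op_norm n n A"
proof -
  have "cmod (y' A) \<le> dual_norm (mat_opspace n) y' * op_norm n n A"
    using functional_le[OF _ seminorm_on_mat_opspace] assms
    by (simp add: dual_ball_def dual_def dual_norm_def vecs_mat_opspace csubspace_matrices vnorm_mat_opspace)
  also have "\<dots> \<le> 1 * op_norm n n A"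
    using assms op_norm_nonneg by (intro mult_right_mono) (auto simp: dual_ball_def)
  finally show ?thesis by simp
qed

text \<open>These functionals \<open>A \<mapsto> \<langle>A v, w\<rangle>\<close> already determine the norm of \<open>M\<^sub>n\<close>. The value 0 off the carrier is
required of elements of the dual.\<close>

definition vector_functional ::
  "nat \<Rightarrow> (nat \<Rightarrow> complex) \<Rightarrow> (nat \<Rightarrow> complex) \<Rightarrow> (nat \<Rightarrow> nat \<Rightarrow> complex) \<Rightarrow> complex"
  where "vector_functional n w v = (\<lambda>A. if A \<in> matrices n n UNIV then pairing n n w A v else 0)"

lemma vector_functional_dual_ball:
  assumes "l2 n w \<le> 1" "l2 n v \<le> 1"
  shows "vector_functional n w v \<in> dual_ball (mat_opspace n)"
proof -
  have le: "cmod (vector_functional n w v A) \<le> 1 * vnorm (mat_opspace n) A" if "A \<in> vecs (mat_opspace n)" for A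
  proof -
    have "op_norm n n A * l2 n w * l2 n v \<le> op_norm n n A * 1 * 1"
      using assms op_norm_nonneg l2_nonneg by (intro mult_mono) auto
    with norm_pairing_le[of n n w A v] op_norm_nonneg[of n n A] show ?thesis
      by (simp add: vector_functional_def vnorm_mat_opspace)
  qed
  have sub: "csubspace (vecs (mat_opspace n))" by (simp add: vecs_mat_opspace csubspace_matrices)
  have "clinear_on (vecs (mat_opspace n)) (vector_functional n w v)"
    using complex_vector.subspace_add[OF sub] complex_vector.subspace_scale[OF sub]
    by (simp add: clinear_on_def vector_functional_def vecs_mat_opspace pairing_def scaleC_fun_def
        scaleC_complex_def algebra_simps sum.distrib sum_distrib_left)
  then have "vector_functional n w v \<in> dual (mat_opspace n)"
    using le unfolding dual_def bounded_maps_def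
    by (auto simp: vecs_mat_opspace vector_functional_def intro!: exI[of _ 1])
  moreover have "dual_norm (mat_opspace n) (vector_functional n w v) \<le> 1"
    unfolding dual_norm_def using le sub by (intro map_norm_le seminorm_on_mat_opspace) auto
  ultimately show ?thesis by (simp add: dual_ball_def)
qed

section \<open>Fourier coefficients of matrix-valued functions\<close>

text \<open>The columns of a unitary matrix are unit vectors, so its entries have modulus at most 1.\<close>

lemma irrepsD:
  assumes "(d, \<pi>) \<in> irreps"
  shows irreps_dim: "1 \<le> d"
    and irreps_measurable: "(\<lambda>t. \<pi> t i j) \<in> borel_measurable borel"
    and irreps_entry: "i < d \<Longrightarrow> j < d \<Longrightarrow> cmod (\<pi> t i j) \<le> 1"
proof -
  show "1 \<le> d" using assms by (simp add: irreps_def irreducible_rep_def)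
  show "(\<lambda>t. \<pi> t i j) \<in> borel_measurable borel"
    using assms by (intro borel_measurable_continuous_onI) (simp add: irreps_def unitary_rep_def)
  assume ij: "i < d" "j < d"
  have "mat_mult d (mat_adj (\<pi> t)) (\<pi> t) j j = 1"
    using assms ij by (simp add: irreps_def unitary_rep_def unitary_mat_def mat_one_def)
  then have "(\<Sum>k<d. complex_of_real ((cmod (\<pi> t k j))\<^sup>2)) = 1"
    unfolding complex_norm_square by (simp add: mat_mult_def mat_adj_def mult.commute)
  then have "complex_of_real (\<Sum>k<d. (cmod (\<pi> t k j))\<^sup>2) = 1" by simp
  then have "(\<Sum>k<d. (cmod (\<pi> t k j))\<^sup>2) = 1" by (metis of_real_eq_1_iff)
  then have "(cmod (\<pi> t i j))\<^sup>2 \<le> 1"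
    using member_le_sum[of i "{..<d}" "\<lambda>k. (cmod (\<pi> t k j))\<^sup>2"] ij by simp
  then show "cmod (\<pi> t i j) \<le> 1" by (simp add: power2_le_iff_abs_le abs_square_le_1)
qed

lemma integrable_times_entry:
  fixes g :: "'g::topological_group_add \<Rightarrow> complex"
  assumes sets_m: "sets m = sets borel" and R: "(d, \<pi>) \<in> irreps" and g: "integrable m g"
    and ij: "i < d" "j < d"
  shows "integrable m (\<lambda>t. g t * mat_adj (\<pi> t) i j)"
proof (rule Bochner_Integration.integrable_bound[OF g])
  have [measurable]: "(\<lambda>t. cnj (\<pi> t j i)) \<in> borel_measurable m"
    using irreps_measurable[OF R] measurable_cong_sets[OF sets_m refl]
    by (auto intro!: borel_measurable_continuous_on[where f=cnj] continuous_intros)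
  show "AE t in m. norm (g t * mat_adj (\<pi> t) i j) \<le> norm (g t)"
    using irreps_entry[OF R ij(2,1)] by (auto simp: mat_adj_def norm_mult intro!: mult_left_le)
  show "(\<lambda>t. g t * mat_adj (\<pi> t) i j) \<in> borel_measurable m"
    unfolding mat_adj_def using g by measurable
qed

text \<open>The block at \<open>(k, l)\<close> is the matrix of the integrals of \<open>g i j\<close> against the function
\<open>(\<pi>(t)\<^sup>*)\<^sub>k\<^sub>l / d\<close>, which is bounded by \<open>1/d\<close>. So the blocks have norm at most \<open>K/d\<close>, and the factor \<open>d\<close>
lost in \<open>op_norm_blocks_le\<close> is regained exactly. The hypothesis \<open>weak\<close> is the weak (Pettis) norm of
\<open>g\<close> rather than the larger integral of the operator norm of \<open>g\<close>.\<close>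

lemma op_norm_fourier_coeff_le:
  fixes g :: "nat \<Rightarrow> nat \<Rightarrow> 'g::topological_group_add \<Rightarrow> complex"
  assumes sets_m: "sets m = sets borel" and R: "(d, \<pi>) \<in> irreps"
    and g: "\<And>i j. i < n \<Longrightarrow> j < n \<Longrightarrow> integrable m (g i j)"
    and K: "0 \<le> K" and weak: "\<And>w v. (\<integral>t. cmod (pairing n n w (\<lambda>i j. g i j t) v) \<partial>m) \<le> K * l2 n w * l2 n v"
  shows "op_norm (n * d) (n * d)
    (\<lambda>r s. fourier_coeff m (g (r div d) (s div d)) (d, \<pi>) (r mod d) (s mod d)) \<le> K"
proof -
  have d: "1 \<le> d" using R by (rule irreps_dim)
  have "op_norm (n * d) (n * d)
    (\<lambda>r s. fourier_coeff m (g (r div d) (s div d)) (d, \<pi>) (r mod d) (s mod d)) \<le> real d * (K / real d)"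
  proof (rule op_norm_blocks_le)
    fix k l and w v :: "nat \<Rightarrow> complex"
    assume kl: "k < d" "l < d"
    let ?p = "\<lambda>t. pairing n n w (\<lambda>i j. g i j t) v"
    have gp: "integrable m (\<lambda>t. g i j t * cnj (\<pi> t l k))" if "i < n" "j < n" for i j
      using integrable_times_entry[OF sets_m R g[OF that] kl] by (simp add: mat_adj_def)
    have p: "integrable m ?p"
      unfolding pairing_def using g by (intro Bochner_Integration.integrable_sum) auto
    have "pairing n n w (\<lambda>i j. fourier_coeff m (g i j) (d, \<pi>) k l) v
        = 1 / of_nat d * (\<Sum>i<n. \<Sum>j<n. cnj (w i) * v j * (\<integral>t. g i j t * cnj (\<pi> t l k) \<partial>m))"
      using kl by (simp add: pairing_def fourier_coeff_def mat_adj_def sum_distrib_left sum_divide_distrib mult_ac)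
    also have "(\<Sum>i<n. \<Sum>j<n. cnj (w i) * v j * (\<integral>t. g i j t * cnj (\<pi> t l k) \<partial>m))
        = (\<integral>t. (\<Sum>i<n. \<Sum>j<n. cnj (w i) * v j * (g i j t * cnj (\<pi> t l k))) \<partial>m)"
    proof -
      have gp': "integrable m (\<lambda>t. cnj (w i) * v j * (g i j t * cnj (\<pi> t l k)))" if "i < n" "j < n" for i j
        using gp[OF that] by (rule integrable_mult_right)
      have "(\<integral>t. (\<Sum>i<n. \<Sum>j<n. cnj (w i) * v j * (g i j t * cnj (\<pi> t l k))) \<partial>m)
          = (\<Sum>i<n. \<integral>t. (\<Sum>j<n. cnj (w i) * v j * (g i j t * cnj (\<pi> t l k))) \<partial>m)"
        using gp' by (intro Bochner_Integration.integral_sum Bochner_Integration.integrable_sum) auto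
      also have "\<dots> = (\<Sum>i<n. \<Sum>j<n. \<integral>t. cnj (w i) * v j * (g i j t * cnj (\<pi> t l k)) \<partial>m)"
        using gp' by (intro sum.cong refl Bochner_Integration.integral_sum) auto
      finally show ?thesis by simp
    qed
    also have "\<dots> = (\<integral>t. ?p t * cnj (\<pi> t l k) \<partial>m)"
      by (simp only: pairing_def sum_distrib_right) (simp only: mult_ac)
    finally have "cmod (pairing n n w (\<lambda>i j. fourier_coeff m (g i j) (d, \<pi>) k l) v)
        = 1 / real d * cmod (\<integral>t. ?p t * cnj (\<pi> t l k) \<partial>m)"
      by (simp add: norm_mult norm_divide)
    also have "\<dots> \<le> 1 / real d * (\<integral>t. cmod (?p t) \<partial>m)"
    proof (rule mult_left_mono)
      have "cmod (\<integral>t. ?p t * cnj (\<pi> t l k) \<partial>m) \<le> (\<integral>t. cmod (?p t * cnj (\<pi> t l k)) \<partial>m)"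
        by (rule integral_norm_bound)
      also have "\<dots> \<le> (\<integral>t. cmod (?p t) \<partial>m)"
        using integrable_norm[OF p] irreps_entry[OF R kl(2,1)]
        by (intro integral_mono') (auto simp: norm_mult intro!: mult_left_le)
      finally show "cmod (\<integral>t. ?p t * cnj (\<pi> t l k) \<partial>m) \<le> (\<integral>t. cmod (?p t) \<partial>m)" .
    qed simp
    also have "\<dots> \<le> 1 / real d * (K * l2 n w * l2 n v)"
      by (intro mult_left_mono weak) simp
    finally show "cmod (pairing n n w (\<lambda>i j. fourier_coeff m (g ((i * d + k) div d) ((j * d + l) div d))
        (d, \<pi>) ((i * d + k) mod d) ((j * d + l) mod d)) v) \<le> K / real d * l2 n w * l2 n v"
      using kl by simp
  qed (use K in simp)
  also have "\<dots> = K" using d by simp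
  finally show ?thesis .
qed

section \<open>Linearity of Fourier coefficients and the dual object\<close>

lemma fourier_coeff_add:
  fixes g :: "'g::topological_group_add \<Rightarrow> complex"
  assumes "sets m = sets borel" "R \<in> irreps" "integrable m g" "integrable m g'"
  shows "fourier_coeff m (\<lambda>t. g t + g' t) R = fourier_coeff m g R + fourier_coeff m g' R"
proof -
  obtain d \<pi> where R: "R = (d, \<pi>)" by (cases R)
  have "(\<integral>t. (g t + g' t) * mat_adj (\<pi> t) i j \<partial>m)
      = (\<integral>t. g t * mat_adj (\<pi> t) i j \<partial>m) + (\<integral>t. g' t * mat_adj (\<pi> t) i j \<partial>m)"
    if "i < d" "j < d" for i j
    using integrable_times_entry[of m d \<pi> g i j] integrable_times_entry[of m d \<pi> g' i j] assms R that
    by (simp add: distrib_right)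
  then show ?thesis by (auto simp: fun_eq_iff fourier_coeff_def R add_divide_distrib)
qed

lemma fourier_coeff_scale: "fourier_coeff m (\<lambda>t. a * g t) R = a *\<^sub>C fourier_coeff m g R"
  by (auto simp: fun_eq_iff fourier_coeff_def scaleC_fun_def scaleC_complex_def mult.assoc split: prod.split)

lemma fourier_coeff_cong_AE:
  fixes g :: "'g::topological_group_add \<Rightarrow> complex"
  assumes m: "sets m = sets borel" and R: "R \<in> irreps" and g: "integrable m g" "integrable m g'"
    and eq: "AE t in m. g t = g' t"
  shows "fourier_coeff m g R = fourier_coeff m g' R"
proof -
  obtain d \<pi> where Rd: "R = (d, \<pi>)" by (cases R)
  have "(\<integral>t. g t * mat_adj (\<pi> t) i j \<partial>m) = (\<integral>t. g' t * mat_adj (\<pi> t) i j \<partial>m)"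
    if "i < d" "j < d" for i j
  proof (rule integral_cong_AE)
    show "AE t in m. g t * mat_adj (\<pi> t) i j = g' t * mat_adj (\<pi> t) i j"
      using eq by eventually_elim simp
  qed (use integrable_times_entry[OF m R[unfolded Rd] _ that] g in \<open>auto intro: borel_measurable_integrable\<close>)
  then show ?thesis by (auto simp: fun_eq_iff fourier_coeff_def Rd)
qed

text \<open>The trivial representation has a class. A supremum of real numbers over the empty set is
unspecified, so estimates of suprema over the dual object depend on this.\<close>

lemma dual_object_nonempty: "(dual_object :: 'g::topological_group_add mat_rep set set) \<noteq> {}"
proof -
  define \<pi> :: "'g \<Rightarrow> nat \<Rightarrow> nat \<Rightarrow> complex" where "\<pi> = (\<lambda>t. mat_one 1)"
  have "mat_adj (mat_one 1) = mat_one 1" "mat_mult 1 (mat_one 1) (mat_one 1) = mat_one 1"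
    by (simp_all add: mat_adj_def mat_mult_def mat_one_def fun_eq_iff)
  moreover have "mat_one 1 \<in> matrices 1 1 UNIV" by (simp add: mat_one_def matrices_def)
  ultimately have "unitary_rep (1, \<pi>)"
    unfolding unitary_rep_def unitary_mat_def prod.case \<pi>_def
    by (simp only: continuous_on_const simp_thms)
  moreover have "irreducible_rep (1, \<pi>)"
    unfolding irreducible_rep_def prod.case
  proof (intro conjI allI impI)
    fix S :: "(nat \<Rightarrow> complex) set"
    assume S: "csubspace S" "S \<subseteq> {v. \<forall>i\<ge>1. v i = 0}"
    show "S = {0} \<or> S = {v. \<forall>i\<ge>1. v i = 0}"
    proof (cases "S \<subseteq> {0}")
      case True
      then show ?thesis using complex_vector.subspace_0[OF S(1)] by blast
    next
      case False
      then obtain u where u: "u \<in> S" "u \<noteq> 0" by blast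
      have su: "w (Suc i) = 0" if "w \<in> {v. \<forall>i\<ge>1. v i = (0::complex)}" for w i using that by simp
      have u1: "u (Suc i) = 0" for i by (rule su) (use u S in blast)
      have u0: "u 0 \<noteq> 0"
      proof
        assume "u 0 = 0"
        with u1 have "u i = 0" for i by (cases i) simp_all
        with u(2) show False by (simp add: fun_eq_iff)
      qed
      have "v \<in> S" if v: "v \<in> {v. \<forall>i\<ge>1. v i = 0}" for v
      proof -
        define a where "a = v 0 / u 0"
        have "v = a *\<^sub>C u"
        proof
          fix i
          show "v i = (a *\<^sub>C u) i"
            using u0 u1 su[OF v] by (cases i) (simp_all add: a_def scaleC_fun_def scaleC_complex_def)
        qed
        moreover have "a *\<^sub>C u \<in> S" using S(1) u(1) by (rule complex_vector.subspace_scale)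
        ultimately show ?thesis by simp
      qed
      with S(2) show ?thesis by blast
    qed
  qed simp
  ultimately have "(1, \<pi>) \<in> irreps" by (simp add: irreps_def)
  then show ?thesis unfolding dual_object_def by (auto simp: quotient_def)
qed

lemma dual_object_subset_irreps: "c \<in> dual_object \<Longrightarrow> c \<subseteq> irreps"
  by (auto simp: dual_object_def quotient_def rep_equiv_def)

lemma vnorm_linf_sum: "vnorm (linf_sum I Y) F = (SUP c\<in>I. vnorm (Y c) (F c))"
proof -
  have "(\<lambda>(i::nat) (j::nat). (if i = 0 \<and> j = 0 then F else 0) c) = (\<lambda>i j. if i = 0 \<and> j = 0 then F c else 0)"
    for c by (auto simp: fun_eq_iff)
  then show ?thesis by (simp only: vnorm_def linf_sum_def opspace.simps)
qed

section \<open>Complete boundedness of the Fourier transform\<close>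

context ac_vector_measure
begin

lemma matrix_entry_L1w:
  assumes "F \<in> matrices n n (vecs (L1w X \<nu>))"
  shows "F i j \<in> vecs (L1w X \<nu>)" and "(\<lambda>i j. F i j t) \<in> matrices n n UNIV"
  using assms complex_vector.subspace_0[OF csubspace_L1w]
  by (cases "i < n \<and> j < n"; auto simp: matrices_def)+

text \<open>A crude bound suffices to make the supremum meaningful: a functional in the unit ball of \<open>(M\<^sub>n)'\<close> is
at most the sum of the moduli of the entries.\<close>

lemma bdd_above_mnorm_L1w:
  assumes F: "F \<in> matrices n n (vecs (L1w X \<nu>))"
  shows "bdd_above ((\<lambda>y'. weak_norm X \<nu> (\<lambda>t. y' (\<lambda>i j. F i j t))) ` dual_ball (mat_opspace n))"
proof (rule bdd_aboveI2)
  fix y' assume y': "y' \<in> dual_ball (mat_opspace n)"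
  show "weak_norm X \<nu> (\<lambda>t. y' (\<lambda>i j. F i j t)) \<le> (\<Sum>i<n. \<Sum>j<n. weak_norm X \<nu> (F i j))"
    unfolding weak_norm_def[of X \<nu> "\<lambda>t. y' (\<lambda>i j. F i j t)"]
  proof (rule cSUP_least)
    have 0: "0 \<in> dual X" by (rule complex_vector.subspace_0[OF csubspace_dual[OF X]])
    then show "dual_ball X \<noteq> {}"
      using seminorm_onD(5)[OF seminorm_on_dual[OF X] 0] by (auto simp: dual_ball_def)
    fix x' assume "x' \<in> dual_ball X"
    then have x': "x' \<in> dual X" "dual_norm X x' \<le> 1" by (auto simp: dual_ball_def)
    let ?T = "total_variation (scalar_meas \<nu> x')"
    have int: "integrable ?T (F i j)" for i j
      using matrix_entry_L1w(1)[OF F] x' by (simp add: L1w_def)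
    have "(\<integral>t. cmod (y' (\<lambda>i j. F i j t)) \<partial>?T) \<le> (\<integral>t. (\<Sum>i<n. \<Sum>j<n. cmod (F i j t)) \<partial>?T)"
    proof (rule integral_mono')
      show "integrable ?T (\<lambda>t. \<Sum>i<n. \<Sum>j<n. cmod (F i j t))"
        using int by (intro Bochner_Integration.integrable_sum integrable_norm)
      show "cmod (y' (\<lambda>i j. F i j t)) \<le> (\<Sum>i<n. \<Sum>j<n. cmod (F i j t))" for t
        using mat_dual_ball_le[OF y' matrix_entry_L1w(2)[OF F]] op_norm_le_sum by (rule order_trans)
    qed (auto intro!: sum_nonneg)
    also have "\<dots> = (\<Sum>i<n. \<Sum>j<n. \<integral>t. cmod (F i j t) \<partial>?T)"
      using int by (simp add: Bochner_Integration.integral_sum)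
    also have "\<dots> \<le> (\<Sum>i<n. \<Sum>j<n. weak_norm X \<nu> (F i j))"
    proof (intro sum_mono)
      fix i j
      have f: "F i j \<in> vecs (L1w X \<nu>)" by (rule matrix_entry_L1w(1)[OF F])
      have "(\<integral>t. cmod (F i j t) \<partial>?T) \<le> weak_norm X \<nu> (F i j) * dual_norm X x'"
        using integral_le_weak_norm[OF f x'(1)] integral_total_variation[OF L1w_measurable[OF f] x'(1)]
        by simp
      also have "\<dots> \<le> weak_norm X \<nu> (F i j)"
        using x' weak_norm_nonneg[OF f] by (intro mult_left_le) auto
      finally show "(\<integral>t. cmod (F i j t) \<partial>?T) \<le> weak_norm X \<nu> (F i j)" .
    qed
    finally show "(\<integral>t. cmod (y' (\<lambda>i j. F i j t)) \<partial>?T) \<le> (\<Sum>i<n. \<Sum>j<n. weak_norm X \<nu> (F i j))" .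
  qed
qed

lemma pairing_L1w:
  assumes F: "F \<in> matrices n n (vecs (L1w X \<nu>))"
  shows "(\<lambda>t. pairing n n w (\<lambda>i j. F i j t) v) \<in> vecs (L1w X \<nu>)"
proof -
  have "(\<lambda>t. pairing n n w (\<lambda>i j. F i j t) v) = (\<Sum>i<n. \<Sum>j<n. (cnj (w i) * v j) *\<^sub>C F i j)"
  proof
    fix t
    have ev: "(\<Sum>i\<in>I. G i) t = (\<Sum>i\<in>I. G i t)" for I and G :: "nat \<Rightarrow> 'g \<Rightarrow> complex"
      by (induction I rule: infinite_finite_induct) auto
    show "pairing n n w (\<lambda>i j. F i j t) v = (\<Sum>i<n. \<Sum>j<n. (cnj (w i) * v j) *\<^sub>C F i j) t"
      by (simp add: ev pairing_def scaleC_fun_def scaleC_complex_def mult_ac)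
  qed
  also have "\<dots> \<in> vecs (L1w X \<nu>)"
    by (intro complex_vector.subspace_sum[OF csubspace_L1w] complex_vector.subspace_scale[OF csubspace_L1w]
        matrix_entry_L1w(1)[OF F])
  finally show ?thesis .
qed

lemma weak_norm_pairing_le:
  assumes F: "F \<in> matrices n n (vecs (L1w X \<nu>))" and wv: "l2 n w \<le> 1" "l2 n v \<le> 1"
  shows "weak_norm X \<nu> (\<lambda>t. pairing n n w (\<lambda>i j. F i j t) v) \<le> mnorm (L1w X \<nu>) n F"
proof -
  have "weak_norm X \<nu> (\<lambda>t. pairing n n w (\<lambda>i j. F i j t) v)
      = weak_norm X \<nu> (\<lambda>t. vector_functional n w v (\<lambda>i j. F i j t))"
    using matrix_entry_L1w(2)[OF F] by (simp add: vector_functional_def)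
  also have "\<dots> \<le> mnorm (L1w X \<nu>) n F"
    unfolding L1w_def opspace.simps
    by (rule cSUP_upper[OF vector_functional_dual_ball[OF wv] bdd_above_mnorm_L1w[OF F]])
  finally show ?thesis .
qed

lemma mnorm_L1w_nonneg:
  assumes F: "F \<in> matrices n n (vecs (L1w X \<nu>))"
  shows "0 \<le> mnorm (L1w X \<nu>) n F"
proof (rule order_trans)
  show "0 \<le> weak_norm X \<nu> (\<lambda>t. pairing n n (\<lambda>_. 0) (\<lambda>i j. F i j t) (\<lambda>_. 0))"
    by (rule weak_norm_nonneg[OF pairing_L1w[OF F]])
  show "weak_norm X \<nu> (\<lambda>t. pairing n n (\<lambda>_. 0) (\<lambda>i j. F i j t) (\<lambda>_. 0)) \<le> mnorm (L1w X \<nu>) n F"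
    by (rule weak_norm_pairing_le[OF F]) (simp_all add: l2_def L2_set_def)
qed

text \<open>\<open>vector_functional\<close> lies in the unit ball of \<open>(M\<^sub>n)'\<close> for vectors of norm at most 1; the general case is
obtained by normalizing \<open>w\<close> and \<open>v\<close>.\<close>

lemma integral_pairing_le:
  assumes F: "F \<in> matrices n n (vecs (L1w X \<nu>))" and x': "x' \<in> dual X"
  shows "(\<integral>t. cmod (pairing n n w (\<lambda>i j. F i j t * h x' t) v) \<partial>m)
    \<le> mnorm (L1w X \<nu>) n F * dual_norm X x' * l2 n w * l2 n v"
proof -
  let ?w = "\<lambda>i. w i / complex_of_real (l2 n w)" and ?v = "\<lambda>j. v j / complex_of_real (l2 n v)"
  have "pairing n n w (\<lambda>i j. F i j t * h x' t) v
      = complex_of_real (l2 n w * l2 n v) * (pairing n n ?w (\<lambda>i j. F i j t) ?v * h x' t)" for t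
    by (subst pairing_normalize) (simp add: pairing_def sum_distrib_left sum_distrib_right mult_ac)
  then have "(\<integral>t. cmod (pairing n n w (\<lambda>i j. F i j t * h x' t) v) \<partial>m)
      = (l2 n w * l2 n v) * (\<integral>t. cmod (pairing n n ?w (\<lambda>i j. F i j t) ?v * h x' t) \<partial>m)"
    by (simp add: norm_mult l2_nonneg mult.assoc)
  also have "\<dots> \<le> (l2 n w * l2 n v) * (mnorm (L1w X \<nu>) n F * dual_norm X x')"
  proof (rule mult_left_mono)
    have "(\<integral>t. cmod (pairing n n ?w (\<lambda>i j. F i j t) ?v * h x' t) \<partial>m)
        \<le> weak_norm X \<nu> (\<lambda>t. pairing n n ?w (\<lambda>i j. F i j t) ?v) * dual_norm X x'"
      by (rule integral_le_weak_norm[OF pairing_L1w[OF F] x'])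
    also have "\<dots> \<le> mnorm (L1w X \<nu>) n F * dual_norm X x'"
      using weak_norm_pairing_le[OF F l2_normalized l2_normalized]
        seminorm_onD(1)[OF seminorm_on_dual[OF X] x'] by (intro mult_right_mono)
    finally show "(\<integral>t. cmod (pairing n n ?w (\<lambda>i j. F i j t) ?v * h x' t) \<partial>m)
        \<le> mnorm (L1w X \<nu>) n F * dual_norm X x'" .
  qed (simp add: l2_nonneg)
  finally show ?thesis by (simp add: mult_ac)
qed

end

locale vector_fourier = ac_vector_measure m X \<nu>
  for m :: "'g::topological_group_add measure" and X :: "'x::complex_vector opspace"
    and \<nu> :: "'g set \<Rightarrow> 'x" +
  fixes rep :: "'g mat_rep set \<Rightarrow> 'g mat_rep"
  assumes rep: "\<forall>c\<in>dual_object. rep c \<in> c"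
begin

abbreviation FT where "FT \<equiv> fourier_transform m X \<nu> rep"

lemma rep_irreps: "c \<in> dual_object \<Longrightarrow> rep c \<in> irreps"
  using rep dual_object_subset_irreps by blast

lemma FT_eq:
  assumes "x' \<in> dual X" "c \<in> dual_object"
  shows "FT f x' c = fourier_coeff m (\<lambda>t. f t * h x' t) (rep c)"
  using assms by (simp add: fourier_transform_def)

lemma FT_matrix: "c \<in> dual_object \<Longrightarrow> FT f x' c \<in> matrices (fst (rep c)) (fst (rep c)) UNIV"
  by (auto simp: fourier_transform_def fourier_coeff_def matrices_def split: prod.split)

text \<open>The bound does not depend on \<open>n\<close> or on the representation, which makes all amplifications of the
Fourier transform contractions.\<close>

lemma amplification_le:
  assumes F: "F \<in> matrices n n (vecs (L1w X \<nu>))" and x': "x' \<in> dual X" and c: "c \<in> dual_object"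
  shows "mnorm (mat_opspace (fst (rep c))) n (\<lambda>i j. FT (F i j) x' c)
    \<le> mnorm (L1w X \<nu>) n F * dual_norm X x'"
proof -
  obtain d \<pi> where R: "rep c = (d, \<pi>)" by (cases "rep c")
  have "op_norm (n * d) (n * d) (\<lambda>r s. fourier_coeff m (\<lambda>t. F (r div d) (s div d) t * h x' t)
      (d, \<pi>) (r mod d) (s mod d)) \<le> mnorm (L1w X \<nu>) n F * dual_norm X x'"
  proof (rule op_norm_fourier_coeff_le[where g="\<lambda>i j t. F i j t * h x' t"])
    show "sets m = sets borel" by (rule sets_m)
    show "(d, \<pi>) \<in> irreps" using rep_irreps[OF c] by (simp add: R)
    show "integrable m (\<lambda>t. F i j t * h x' t)" for i j
      by (rule L1w_integrable[OF matrix_entry_L1w(1)[OF F] x'])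
    show "0 \<le> mnorm (L1w X \<nu>) n F * dual_norm X x'"
      using mnorm_L1w_nonneg[OF F] seminorm_onD(1)[OF seminorm_on_dual[OF X] x'] by simp
    show "(\<integral>t. cmod (pairing n n w (\<lambda>i j. F i j t * h x' t) v) \<partial>m)
        \<le> mnorm (L1w X \<nu>) n F * dual_norm X x' * l2 n w * l2 n v" for w v
      by (rule integral_pairing_le[OF F x'])
  qed
  then show ?thesis by (simp add: mat_opspace_def FT_eq[OF x' c] R)
qed

text \<open>For \<open>1 \<times> 1\<close> matrices the pairing is the product \<open>cnj (w 0) * f * v 0\<close>, so the weak norm of the
matrix is that of \<open>f\<close>.\<close>

lemma FT_bound:
  assumes f: "f \<in> vecs (L1w X \<nu>)" and x': "x' \<in> dual X" and c: "c \<in> dual_object"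
  shows "op_norm (fst (rep c)) (fst (rep c)) (FT f x' c) \<le> weak_norm X \<nu> f * dual_norm X x'"
proof -
  obtain d \<pi> where R: "rep c = (d, \<pi>)" by (cases "rep c")
  let ?g = "\<lambda>t. f t * h x' t"
  have "op_norm (1 * d) (1 * d) (\<lambda>r s. fourier_coeff m ?g (d, \<pi>) (r mod d) (s mod d))
      \<le> weak_norm X \<nu> f * dual_norm X x'"
  proof (rule op_norm_fourier_coeff_le[where g="\<lambda>i j. ?g"])
    show "sets m = sets borel" by (rule sets_m)
    show "(d, \<pi>) \<in> irreps" using rep_irreps[OF c] by (simp add: R)
    show "integrable m ?g" by (rule L1w_integrable[OF f x'])
    show "0 \<le> weak_norm X \<nu> f * dual_norm X x'"
      using weak_norm_nonneg[OF f] seminorm_onD(1)[OF seminorm_on_dual[OF X] x'] by simp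
    show "(\<integral>t. cmod (pairing 1 1 w (\<lambda>i j. ?g t) v) \<partial>m)
        \<le> weak_norm X \<nu> f * dual_norm X x' * l2 1 w * l2 1 v" for w v
    proof -
      have l2_1: "l2 1 u = cmod (u 0)" for u by (simp add: l2_def L2_set_def)
      have "(\<integral>t. cmod (pairing 1 1 w (\<lambda>i j. ?g t) v) \<partial>m)
          = (l2 1 w * l2 1 v) * (\<integral>t. cmod (?g t) \<partial>m)"
        unfolding l2_1 by (simp add: pairing_def norm_mult mult_ac flip: integral_mult_right_zero)
      also have "\<dots> \<le> (l2 1 w * l2 1 v) * (weak_norm X \<nu> f * dual_norm X x')"
        by (intro mult_left_mono integral_le_weak_norm[OF f x']) (simp add: l2_nonneg)
      finally show ?thesis by (simp add: mult_ac)
    qed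
  qed
  also have "op_norm (1 * d) (1 * d) (\<lambda>r s. fourier_coeff m ?g (d, \<pi>) (r mod d) (s mod d))
      = op_norm d d (fourier_coeff m ?g (d, \<pi>))"
    unfolding mult_1 by (rule op_norm_cong) simp
  finally show ?thesis by (simp add: FT_eq[OF x' c] R)
qed

lemma SUP_FT_le:
  assumes "f \<in> vecs (L1w X \<nu>)" "x' \<in> dual X"
  shows "(SUP c\<in>dual_object. op_norm (fst (rep c)) (fst (rep c)) (FT f x' c))
    \<le> weak_norm X \<nu> f * dual_norm X x'"
  using assms by (intro cSUP_least dual_object_nonempty FT_bound)

lemma FT_linear_dual:
  assumes f: "f \<in> vecs (L1w X \<nu>)"
  shows "clinear_on (dual X) (FT f)"
  unfolding clinear_on_def
proof (intro conjI ballI allI)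
  fix x' y' assume x': "x' \<in> dual X" and y': "y' \<in> dual X"
  have xy: "x' + y' \<in> dual X" using csubspace_dual[OF X] x' y' by (rule complex_vector.subspace_add)
  show "FT f (x' + y') = FT f x' + FT f y'"
  proof
    fix c
    show "FT f (x' + y') c = (FT f x' + FT f y') c"
    proof (cases "c \<in> dual_object")
      case True
      have "FT f (x' + y') c = fourier_coeff m (\<lambda>t. f t * h x' t + f t * h y' t) (rep c)"
        unfolding FT_eq[OF xy True]
      proof (rule fourier_coeff_cong_AE[OF sets_m rep_irreps[OF True]])
        show "AE t in m. f t * h (x' + y') t = f t * h x' t + f t * h y' t"
          using h_add[OF x' y'] by eventually_elim (simp add: distrib_left)
      qed (use L1w_integrable[OF f] x' y' xy in auto)
      then show ?thesis
        using fourier_coeff_add[OF sets_m rep_irreps[OF True] L1w_integrable[OF f x'] L1w_integrable[OF f y']]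
        by (simp add: FT_eq[OF x' True] FT_eq[OF y' True])
    qed (simp add: fourier_transform_def)
  qed
next
  fix a x' assume x': "x' \<in> dual X"
  have ax: "a *\<^sub>C x' \<in> dual X" using csubspace_dual[OF X] x' by (rule complex_vector.subspace_scale)
  show "FT f (a *\<^sub>C x') = a *\<^sub>C FT f x'"
  proof
    fix c
    show "FT f (a *\<^sub>C x') c = (a *\<^sub>C FT f x') c"
    proof (cases "c \<in> dual_object")
      case True
      have "FT f (a *\<^sub>C x') c = fourier_coeff m (\<lambda>t. a * (f t * h x' t)) (rep c)"
        unfolding FT_eq[OF ax True]
      proof (rule fourier_coeff_cong_AE[OF sets_m rep_irreps[OF True]])
        show "AE t in m. f t * h (a *\<^sub>C x') t = a * (f t * h x' t)"
          using h_scale[OF x', of a] by eventually_elim simp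
      qed (use L1w_integrable[OF f] x' ax in auto)
      then show ?thesis
        unfolding fourier_coeff_scale by (simp add: FT_eq[OF x' True] scaleC_fun_def)
    qed (simp add: fourier_transform_def scaleC_fun_def fun_eq_iff)
  qed
qed

lemma FT_linear: "clinear_on (vecs (L1w X \<nu>)) FT"
  unfolding clinear_on_def
proof (intro conjI ballI allI)
  fix f g assume f: "f \<in> vecs (L1w X \<nu>)" and g: "g \<in> vecs (L1w X \<nu>)"
  show "FT (f + g) = FT f + FT g"
  proof (rule ext, rule ext)
    fix x' c
    show "FT (f + g) x' c = (FT f + FT g) x' c"
    proof (cases "x' \<in> dual X \<and> c \<in> dual_object")
      case True
      then have x': "x' \<in> dual X" and c: "c \<in> dual_object" by auto
      show ?thesis
        using fourier_coeff_add[OF sets_m rep_irreps[OF c] L1w_integrable[OF f x'] L1w_integrable[OF g x']]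
        by (simp add: FT_eq[OF x' c] distrib_right)
    qed (auto simp: fourier_transform_def)
  qed
next
  fix a f
  show "FT (a *\<^sub>C f) = a *\<^sub>C FT f"
    by (auto simp: fun_eq_iff fourier_transform_def scaleC_fun_def scaleC_complex_def mult.assoc
        fourier_coeff_scale[unfolded scaleC_fun_def scaleC_complex_def])
qed

lemma FT_dual_maps:
  assumes f: "f \<in> vecs (L1w X \<nu>)"
  shows "FT f \<in> vecs (dual_maps X (fourier_range rep))"
proof -
  have "FT f x' \<in> vecs (fourier_range rep)" if x': "x' \<in> dual X" for x'
    using FT_matrix FT_bound[OF f x']
    by (auto simp: fourier_range_def linf_sum_def vecs_mat_opspace vnorm_mat_opspace fourier_transform_def
        intro!: bdd_aboveI2)
  moreover have "vnorm (fourier_range rep) (FT f x') \<le> weak_norm X \<nu> f * dual_norm X x'"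
    if "x' \<in> dual X" for x'
    using SUP_FT_le[OF f that] by (simp add: fourier_range_def vnorm_linf_sum vnorm_mat_opspace)
  moreover have "FT f x' = 0" if "x' \<notin> dual X" for x'
    using that by (simp add: fourier_transform_def fun_eq_iff)
  ultimately show ?thesis
    using FT_linear_dual[OF f] unfolding dual_maps_def bounded_maps_def opspace.simps by blast
qed

lemma FT_completely_bounded:
  "completely_bounded (L1w X \<nu>) (dual_maps X (fourier_range rep)) FT"
proof -
  have "mnorm (dual_maps X (fourier_range rep)) n (\<lambda>i j. FT (F i j)) \<le> 1"
    if F: "F \<in> matrices n n (vecs (L1w X \<nu>))" and le1: "mnorm (L1w X \<nu>) n F \<le> 1" for n F
    unfolding dual_maps_def opspace.simps
  proof (rule map_norm_le[OF csubspace_dual[OF X] seminorm_on_dual[OF X]])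
    fix x' assume x': "x' \<in> dual X"
    have "mnorm (fourier_range rep) n (\<lambda>i j. FT (F i j) x') \<le> mnorm (L1w X \<nu>) n F * dual_norm X x'"
      unfolding fourier_range_def linf_sum_def opspace.simps
      by (intro cSUP_least dual_object_nonempty amplification_le[OF F x'])
    also have "\<dots> \<le> 1 * dual_norm X x'"
      using le1 seminorm_onD(1)[OF seminorm_on_dual[OF X] x'] by (intro mult_right_mono)
    finally show "mnorm (fourier_range rep) n (\<lambda>i j. FT (F i j) x') \<le> 1 * dual_norm X x'" .
  qed simp
  then have "(SUP n\<in>{1..}. SUP F\<in>{F \<in> matrices n n (vecs (L1w X \<nu>)). mnorm (L1w X \<nu>) n F \<le> 1}.
       ereal (mnorm (dual_maps X (fourier_range rep)) n (\<lambda>i j. FT (F i j)))) \<le> ereal 1"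
    by (intro SUP_least) simp
  also have "ereal 1 < \<infinity>" by simp
  finally show ?thesis
    using FT_linear FT_dual_maps unfolding completely_bounded_def by blast
qed

end

theorem theorem4p7:
  fixes m :: "'g::{topological_group_add, t2_space} measure"
    and X :: "'x::complex_vector opspace"
    and \<nu> :: "'g set \<Rightarrow> 'x"
    and rep :: "'g mat_rep set \<Rightarrow> 'g mat_rep"
  assumes "compact (UNIV :: 'g set)"
    and "normalized_haar m"
    and "complete_operator_space X"
    and "\<nu> \<in> Mac m X"
    and "\<forall>c\<in>dual_object. rep c \<in> c"
  shows "(\<forall>f\<in>vecs (L1w X \<nu>).
            fourier_transform m X \<nu> rep f \<in> vecs (dual_maps X (fourier_range rep)) \<and>
            (\<forall>x'\<in>dual X.
               (SUP c\<in>dual_object.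
                  op_norm (fst (rep c)) (fst (rep c)) (fourier_transform m X \<nu> rep f x' c))
               \<le> weak_norm X \<nu> f * dual_norm X x')) \<and>
         completely_bounded (L1w X \<nu>) (dual_maps X (fourier_range rep))
           (fourier_transform m X \<nu> rep)"
proof -
  have sets_m: "sets m = sets borel" and total: "emeasure m UNIV = 1"
    using assms(2) by (simp_all add: normalized_haar_def)
  have "finite_measure m"
    using total sets_eq_imp_space_eq[OF sets_m] by (intro finite_measureI) simp
  then interpret vector_fourier m X \<nu> rep
    using sets_m assms(3-5)
    by (intro vector_fourier.intro ac_vector_measure.intro vector_fourier_axioms.intro)
      (simp_all add: complete_operator_space_def)
  show ?thesis
    using FT_dual_maps SUP_FT_le FT_completely_bounded by blast
qed

end
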